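(* Let $\mathcal{X}$ and $\mathcal{Y}$ be compact real domains such that $\max\mathcal{X}>\min\mathcal{X}>\max\mathcal{Y}>\min\mathcal{Y}$. The maximum relative pointwise error in rank-$r$ approximations of $1/(x-y)$, minimized over the sets of real-valued functions $\mathcal{F}(\mathcal{X})$ and $\mathcal{F}(\mathcal{Y})$ on $\mathcal{X}$ and $\mathcal{Y}$, reduces to $$\min_{\substack{\mathbf{f}\in\mathcal{F}(\mathcal{X})^r\\ \mathbf{g}\in\mathcal{F}(\mathcal{Y})^r}}\ \max_{\substack{x\in\mathcal{X}\\ y\in\mathcal{Y}}}\left|1-(x-y)\,\mathbf{f}(x)^T\mathbf{g}(y)\right| = Z_r(\mathcal{X},\mathcal{Y}) \qquad \text{(A)}$$ for the Zolotarev number $Z_r(\mathcal{X},\mathcal{Y})$, which can be defined on such domains as $$Z_r(\mathcal{X},\mathcal{Y}) := \min_{\substack{\tilde{\mathbf{x}}\in[\min\mathcal{X},\max\mathcal{X}]^r\\ \tilde{\mathbf{y}}\in[\min\mathcal{Y},\max\mathcal{Y}]^r}}\ \max_{\substack{x\in\mathcal{X}\\ y\in\mathcal{Y}}}\left|\prod_{i=1}^r\frac{(x-\tilde{x}_i)(y-\tilde{y}_i)}{(x-\tilde{y}_i)(y-\tilde{x}_i)}\right|. \qquad \text{(B)}$$ Minimizers $\mathbf{f},\mathbf{g}$ of (A) and minimizers $\tilde{\mathbf{x}},\tilde{\mathbf{y}}$ of (B) are related by a skeleton decomposition, $$\mathbf{f}(x)^T\mathbf{g}(y)=\mathbf{C}(x,\tilde{\mathbf{y}})\,\mathbf{C}(\tilde{\mathbf{x}},\tilde{\mathbf{y}})^{-1}\,\mathbf{C}(\tilde{\mathbf{x}},y),\qquad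 [\mathbf{C}(\mathbf{x},\mathbf{y})]_{i,j}:=\frac{1}{x_i-y_j}.$$
   Context: Here $r$ is a positive integer (the rank). An element $\mathbf{f}\in\mathcal{F}(\mathcal{X})^r$ is an $r$-tuple of real-valued functions on $\mathcal{X}$, so $\mathbf{f}(x)\in\mathbb{R}^r$ for $x\in\mathcal{X}$, and similarly for $\mathbf{g}\in\mathcal{F}(\mathcal{Y})^r$. $\mathbf{C}(\mathbf{x},\mathbf{y})$ is the Cauchy matrix of the vectors $\mathbf{x}$ and $\mathbf{y}$; a scalar argument is treated as a vector of length 1, so $\mathbf{C}(x,\tilde{\mathbf{y}})$ is a $1\times r$ row and $\mathbf{C}(\tilde{\mathbf{x}},y)$ is an $r\times 1$ column. *)

theory Defs
  imports "HOL-Analysis.Analysis"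
begin

text \<open>The rank is \<open>r = CARD('r)\<close>. For nonempty compact \<open>X\<close>, \<open>min X = Inf X\<close> and \<open>max X = Sup X\<close>.\<close>

definition cauchy_matrix :: "real ^ 'm \<Rightarrow> real ^ 'n \<Rightarrow> real ^ 'n ^ 'm" where
  "cauchy_matrix x y = (\<chi> i j. 1 / (x $ i - y $ j))"

text \<open>Scalars enter the Cauchy matrices as vectors of length 1, so the product is a 1 by 1 matrix.\<close>

definition skeleton :: "real ^ 'r \<Rightarrow> real ^ 'r \<Rightarrow> real \<Rightarrow> real \<Rightarrow> real" where
  "skeleton xt yt x y =
    (cauchy_matrix (vec x :: real ^ 1) yt ** matrix_inv (cauchy_matrix xt yt)
      ** cauchy_matrix xt (vec y :: real ^ 1)) $ 1 $ 1"

text \<open>The functions \<open>f\<close> and \<open>g\<close> are arbitrary, so the error may be unbounded: the maximum is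
  taken as a supremum in the extended reals. Only the values of \<open>f\<close> on \<open>X\<close> and of \<open>g\<close> on \<open>Y\<close>
  matter, so total functions represent the functions on \<open>X\<close> and on \<open>Y\<close>.\<close>

definition max_rel_error ::
  "real set \<Rightarrow> real set \<Rightarrow> (real \<Rightarrow> real ^ 'r) \<Rightarrow> (real \<Rightarrow> real ^ 'r) \<Rightarrow> ereal" where
  "max_rel_error X Y f g = (SUP x\<in>X. SUP y\<in>Y. ereal \<bar>1 - (x - y) * (f x \<bullet> g y)\<bar>)"

definition low_rank_minimizer ::
  "real set \<Rightarrow> real set \<Rightarrow> (real \<Rightarrow> real ^ 'r) \<Rightarrow> (real \<Rightarrow> real ^ 'r) \<Rightarrow> bool" where
  "low_rank_minimizer X Y f g \<longleftrightarrow>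
    is_arg_min (\<lambda>(f, g). max_rel_error X Y f g) (\<lambda>_. True) (f, g)"

definition hull_box :: "real set \<Rightarrow> (real ^ 'r) set" where
  "hull_box X = {xt. \<forall>i. xt $ i \<in> {Inf X..Sup X}}"

text \<open>If \<open>Sup Y < Inf X\<close>, the denominators below do not vanish for \<open>x \<in> X\<close>, \<open>y \<in> Y\<close> and
  parameters in the boxes, so for compact \<open>X\<close> and \<open>Y\<close> this real supremum is a maximum.\<close>

definition zolotarev_max :: "real set \<Rightarrow> real set \<Rightarrow> real ^ 'r \<Rightarrow> real ^ 'r \<Rightarrow> real" where
  "zolotarev_max X Y xt yt =
    (SUP (x, y)\<in>X \<times> Y.
      \<bar>\<Prod>i\<in>UNIV. ((x - xt $ i) * (y - yt $ i)) / ((x - yt $ i) * (y - xt $ i))\<bar>)"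

definition zolotarev_minimizer :: "real set \<Rightarrow> real set \<Rightarrow> real ^ 'r \<Rightarrow> real ^ 'r \<Rightarrow> bool" where
  "zolotarev_minimizer X Y xt yt \<longleftrightarrow>
    is_arg_min (\<lambda>(xt, yt). zolotarev_max X Y xt yt)
      (\<lambda>(xt, yt). xt \<in> hull_box X \<and> yt \<in> hull_box Y) (xt, yt)"

definition zolotarev_number :: "'r::finite itself \<Rightarrow> real set \<Rightarrow> real set \<Rightarrow> real" where
  "zolotarev_number _ X Y =
    (INF (xt, yt)\<in>(hull_box X :: (real ^ 'r) set) \<times> (hull_box Y :: (real ^ 'r) set).
      zolotarev_max X Y xt yt)"

end

theory Submission
  imports Defs
begin

text \<open>Write \<open>E x y = 1 - (x - y) * (f x \<bullet> g y)\<close>.  For distinct nodes in the two hulls the skeleton of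
the Cauchy kernel has exactly the error
\<open>E x y = (\<Prod>i. (x - xt i) * (y - yt i) / ((x - yt i) * (y - xt i)))\<close> (\<open>skeleton_error\<close>), so the
Zolotarev problem is the low-rank problem restricted to skeletons.  What has to be shown is that no
other rank \<open>r\<close> approximation does better, and that optimal nodes are distinct.

Replacing \<open>y\<close> by \<open>- y\<close> and the nodes \<open>yt\<close> by \<open>- b\<close> makes the kernel \<open>1 / (x + y)\<close> and the error
symmetric under exchange of \<open>(x, a)\<close> with \<open>(y, b)\<close>; most of the proof is done in this form.  Its
centre is an \<^emph>\<open>equioscillation\<close>: points \<open>x 0 > \<dots> > x r\<close> and \<open>y 0 > \<dots> > y r\<close> separated by nodes
\<open>a\<close> and \<open>b\<close>, such that the product has the same modulus \<open>\<mu> > 0\<close> at all pairs \<open>(x i, y j)\<close>.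

\<^item> Existence (\<open>equioscillation_exists\<close>).  If both sets have more than \<open>r\<close> points, maximise the
smallest of these moduli over all choices of the points in \<open>X\<close> and \<open>Y\<close> and of interlacing nodes, a
compact family.  At a maximiser no modulus can exceed the minimum: a strict inequality somewhere is spread to
all pairs by one step of a power iteration for a positive matrix (\<open>power_step_improves\<close>), and a point
of \<open>X\<close> or \<open>Y\<close> at which the product is too large may replace the point in the same gap between nodes.
So the product equioscillates and its maximum over \<open>X\<close> and \<open>Y\<close> is \<open>\<mu>\<close>.

\<^item> Lower bound (\<open>equioscillation_lower_bound\<close>).  A rank \<open>r\<close> approximation has a null vector on the
\<open>r + 1\<close> points \<open>y j\<close>.  If its error were below \<open>\<mu>\<close> at all pairs, then comparing this null vector
with that of the skeleton would give a polynomial of degree at most \<open>r\<close> that alternates at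
\<open>r + 2\<close> points.

\<^item> Distinct nodes (\<open>equioscillation_forces_distinct_nodes\<close>).  If other nodes are as good, then the
difference of the two rational functions, cleared of denominators, has degree at most \<open>2 r\<close> and
alternates weakly at \<open>2 r + 2\<close> points; so it vanishes and both have the same zeros.

If \<open>X\<close> or \<open>Y\<close> has at most \<open>r\<close> points, nodes covering it make the error zero.\<close>

section \<open>Lagrange interpolation of alternating data\<close>

definition root_poly :: "'i set \<Rightarrow> ('i \<Rightarrow> real) \<Rightarrow> real poly" where
  "root_poly A a = (\<Prod>i\<in>A. [:- a i, 1:])"

lemma poly_root_poly: "poly (root_poly A a) t = (\<Prod>i\<in>A. (t - a i))"
  unfolding root_poly_def poly_prod by simp

lemma degree_root_poly: "finite A \<Longrightarrow> degree (root_poly A a) = card A"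
  unfolding root_poly_def by (subst degree_prod_eq_sum_degree) auto

definition lagrange_basis :: "'i set \<Rightarrow> ('i \<Rightarrow> real) \<Rightarrow> 'i \<Rightarrow> real \<Rightarrow> real" where
  "lagrange_basis A x i t = (\<Prod>k\<in>A - {i}. (t - x k) / (x i - x k))"

definition lagrange_poly :: "'i set \<Rightarrow> ('i \<Rightarrow> real) \<Rightarrow> ('i \<Rightarrow> real) \<Rightarrow> real poly" where
  "lagrange_poly A x c =
    (\<Sum>i\<in>A. smult (c i / (\<Prod>k\<in>A - {i}. (x i - x k))) (root_poly (A - {i}) x))"

lemma poly_lagrange_poly: "poly (lagrange_poly A x c) t = (\<Sum>i\<in>A. c i * lagrange_basis A x i t)"
  unfolding lagrange_poly_def lagrange_basis_def poly_sum
  by (simp add: poly_root_poly prod_dividef)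

lemma degree_lagrange_poly:
  assumes "finite A" and "card A = Suc n"
  shows "degree (lagrange_poly A x c) \<le> n"
  unfolding lagrange_poly_def
proof (rule degree_sum_le)
  fix i assume "i \<in> A"
  then have "degree (root_poly (A - {i}) x) = n"
    using assms by (simp add: degree_root_poly)
  then show "degree (smult (c i / (\<Prod>k\<in>A - {i}. x i - x k)) (root_poly (A - {i}) x)) \<le> n"
    by (metis degree_smult_le)
qed (use assms in simp)

lemma lagrange_basis_same:
  assumes "inj_on x A" and "i \<in> A"
  shows "lagrange_basis A x i (x i) = 1"
  unfolding lagrange_basis_def
  by (rule prod.neutral) (use assms in \<open>auto simp: inj_on_def\<close>)

lemma lagrange_basis_other:
  assumes "finite A" and "k \<in> A" and "k \<noteq> i"
  shows "lagrange_basis A x i (x k) = 0"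
  unfolding lagrange_basis_def
  by (rule prod_zero) (use assms in auto)

lemma poly_lagrange_poly_node:
  assumes "finite A" and "inj_on x A" and "i \<in> A"
  shows "poly (lagrange_poly A x c) (x i) = c i"
proof -
  have "(\<Sum>k\<in>A. c k * lagrange_basis A x k (x i)) = (\<Sum>k\<in>A. if k = i then c i else 0)"
    using assms by (intro sum.cong) (auto simp: lagrange_basis_same lagrange_basis_other)
  then show ?thesis using assms by (simp add: poly_lagrange_poly)
qed

lemma lagrange_interpolation:
  assumes "finite A" and "inj_on x A" and "degree P < card A"
  shows "poly P t = (\<Sum>i\<in>A. poly P (x i) * lagrange_basis A x i t)"
proof -
  obtain n where n: "card A = Suc n" using assms(3) by (cases "card A") auto
  have "P = lagrange_poly A x (\<lambda>i. poly P (x i))"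
  proof (rule poly_eqI_degree[where A = "x ` A"])
    show "card (x ` A) > degree P" using assms by (simp add: card_image)
    show "card (x ` A) > degree (lagrange_poly A x (\<lambda>i. poly P (x i)))"
      using assms n degree_lagrange_poly[OF assms(1) n] by (simp add: card_image le_imp_less_Suc)
  qed (use assms poly_lagrange_poly_node in fastforce)
  then show ?thesis by (metis poly_lagrange_poly)
qed

text \<open>The two hypotheses say that \<open>x 0, \<dots>, x n, t\<close> is a strictly monotone sequence, increasing or
  decreasing: seen from \<open>t\<close>, the points with a smaller index lie beyond \<open>x i\<close>, those with a larger
  index in front of it, and only the latter contribute a negative factor.\<close>

lemma lagrange_basis_sign:
  fixes x :: "nat \<Rightarrow> real"
  assumes "i \<le> n"
    and beyond: "\<And>i k. k < i \<Longrightarrow> i \<le> n \<Longrightarrow> 0 < (t - x k) * (x i - x k)"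
    and front: "\<And>i k. i < k \<Longrightarrow> k \<le> n \<Longrightarrow> (t - x k) * (x i - x k) < 0"
  shows "0 < (-1) ^ (n - i) * lagrange_basis {..n} x i t"
proof -
  have split: "{..n} - {i} = {..<i} \<union> {i<..n}" using assms(1) by auto
  have "lagrange_basis {..n} x i t
      = (\<Prod>k<i. (t - x k) / (x i - x k)) * (\<Prod>k\<in>{i<..n}. (t - x k) / (x i - x k))"
    unfolding lagrange_basis_def split by (rule prod.union_disjoint) auto
  also have "(\<Prod>k\<in>{i<..n}. (t - x k) / (x i - x k))
      = (-1) ^ (n - i) * (\<Prod>k\<in>{i<..n}. - ((t - x k) / (x i - x k)))"
    by (subst prod_uminus) (simp flip: power_mult_distrib)
  finally have "(-1) ^ (n - i) * lagrange_basis {..n} x i t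
      = ((-1) ^ (n - i) * (-1) ^ (n - i)) * (\<Prod>k<i. (t - x k) / (x i - x k))
        * (\<Prod>k\<in>{i<..n}. - ((t - x k) / (x i - x k)))"
    by (simp only: mult_ac)
  also have "\<dots> = (\<Prod>k<i. (t - x k) / (x i - x k))
        * (\<Prod>k\<in>{i<..n}. - ((t - x k) / (x i - x k)))"
    by (simp flip: power_mult_distrib)
  also have "\<dots> > 0"
  proof (intro mult_pos_pos prod_pos)
    fix k assume "k \<in> {..<i}"
    then show "0 < (t - x k) / (x i - x k)"
      using beyond[of k i] assms(1) by (auto simp: zero_less_mult_iff zero_less_divide_iff)
  next
    fix k assume "k \<in> {i<..n}"
    then show "0 < - ((t - x k) / (x i - x k))"
      using front[of i k] by (auto simp: mult_less_0_iff divide_less_0_iff)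
  qed
  finally show ?thesis .
qed

definition decreasing_to :: "nat \<Rightarrow> (nat \<Rightarrow> real) \<Rightarrow> bool" where
  "decreasing_to n x \<longleftrightarrow> (\<forall>i k. i < k \<longrightarrow> k \<le> n \<longrightarrow> x k < x i)"

lemma decreasing_to_inj: "decreasing_to n x \<Longrightarrow> inj_on x {..n}"
  unfolding decreasing_to_def by (rule linorder_inj_onI') force

lemma lagrange_basis_sign_below:
  assumes "decreasing_to n x" and "\<And>i. i \<le> n \<Longrightarrow> t < x i" and "i \<le> n"
  shows "0 < (-1) ^ (n - i) * lagrange_basis {..n} x i t"
proof (rule lagrange_basis_sign[OF assms(3)])
  fix i k :: nat assume "k < i" "i \<le> n"
  then show "0 < (t - x k) * (x i - x k)"
    using assms by (intro mult_neg_neg) (auto simp: decreasing_to_def)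
next
  fix i k :: nat assume "i < k" "k \<le> n"
  then show "(t - x k) * (x i - x k) < 0"
    using assms by (intro mult_neg_pos) (auto simp: decreasing_to_def)
qed

lemma abs_lagrange_basis_pos:
  assumes "decreasing_to n x" and "\<And>i. i \<le> n \<Longrightarrow> t < x i" and "i \<le> n"
  shows "0 < \<bar>lagrange_basis {..n} x i t\<bar>"
  using lagrange_basis_sign_below[OF assms] by auto

text \<open>The signs of the data and of the Lagrange basis cancel, so the interpolation formula has no
  cancellation: this turns a polynomial identity into a positive linear map between magnitudes.\<close>

lemma alternating_signed_below:
  fixes P :: "real poly"
  assumes "decreasing_to n x" and "\<And>i. i \<le> n \<Longrightarrow> t < x i" and "degree P \<le> n"
    and alt: "\<And>i. i \<le> n \<Longrightarrow> 0 \<le> (-1) ^ i * poly P (x i)"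
  shows "(-1) ^ n * poly P t = (\<Sum>i\<le>n. \<bar>poly P (x i)\<bar> * \<bar>lagrange_basis {..n} x i t\<bar>)"
proof -
  have "poly P t = (\<Sum>i\<le>n. poly P (x i) * lagrange_basis {..n} x i t)"
    using assms by (intro lagrange_interpolation decreasing_to_inj) auto
  then have "(-1) ^ n * poly P t = (\<Sum>i\<le>n. (-1) ^ n * (poly P (x i) * lagrange_basis {..n} x i t))"
    by (simp add: sum_distrib_left)
  also have "\<dots> = (\<Sum>i\<le>n. \<bar>poly P (x i)\<bar> * \<bar>lagrange_basis {..n} x i t\<bar>)"
  proof (rule sum.cong)
    fix i assume "i \<in> {..n}"
    then have i: "i \<le> n" by simp
    have a: "\<bar>poly P (x i)\<bar> = (-1) ^ i * poly P (x i)"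
      using alt[OF i] by (cases "even i") auto
    have b: "\<bar>lagrange_basis {..n} x i t\<bar> = (-1) ^ (n - i) * lagrange_basis {..n} x i t"
      using lagrange_basis_sign_below[OF assms(1,2) i] by (cases "even (n - i)") auto
    have "(-1 :: real) ^ n = (-1) ^ i * (-1) ^ (n - i)"
      using i by (simp flip: power_add)
    then show "(-1) ^ n * (poly P (x i) * lagrange_basis {..n} x i t)
        = \<bar>poly P (x i)\<bar> * \<bar>lagrange_basis {..n} x i t\<bar>"
      unfolding a b by simp
  qed simp
  finally show ?thesis .
qed

lemma alternating_abs_below:
  fixes P :: "real poly"
  assumes "decreasing_to n x" and "\<And>i. i \<le> n \<Longrightarrow> t < x i" and "degree P \<le> n"
    and alt: "\<And>i. i \<le> n \<Longrightarrow> 0 \<le> (-1) ^ i * poly P (x i)"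
  shows "\<bar>poly P t\<bar> = (\<Sum>i\<le>n. \<bar>poly P (x i)\<bar> * \<bar>lagrange_basis {..n} x i t\<bar>)"
proof -
  have "(-1) ^ n * poly P t = (\<Sum>i\<le>n. \<bar>poly P (x i)\<bar> * \<bar>lagrange_basis {..n} x i t\<bar>)"
    by (rule alternating_signed_below) (use assms in auto)
  moreover from this have "0 \<le> (-1) ^ n * poly P t" by (simp add: sum_nonneg)
  ultimately show ?thesis by (cases "even n") auto
qed

text \<open>Counting sign changes without looking at zeros: extrapolated from the first \<open>n + 1\<close> points to the
last one, the polynomial would have the sign opposite to the prescribed one unless all values vanish.
Weak inequalities suffice, which makes multiple zeros harmless.\<close>

lemma alternating_poly_eq_0:
  fixes P :: "real poly"
  assumes "decreasing_to (Suc n) x" and deg: "degree P \<le> n"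
    and alt: "\<And>i. i \<le> Suc n \<Longrightarrow> 0 \<le> (-1) ^ i * poly P (x i)"
  shows "P = 0"
proof -
  let ?t = "x (Suc n)"
  have dec: "decreasing_to n x" and below: "\<And>i. i \<le> n \<Longrightarrow> ?t < x i"
    using assms(1) by (auto simp: decreasing_to_def)
  have "(\<Sum>i\<le>n. \<bar>poly P (x i)\<bar> * \<bar>lagrange_basis {..n} x i ?t\<bar>) = (-1) ^ n * poly P ?t"
    using alternating_signed_below[OF dec below deg] alt by simp
  also have "\<dots> \<le> 0" using alt[of "Suc n"] by simp
  finally have "(\<Sum>i\<le>n. \<bar>poly P (x i)\<bar> * \<bar>lagrange_basis {..n} x i ?t\<bar>) = 0"
    by (meson abs_ge_zero antisym mult_nonneg_nonneg sum_nonneg)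
  then have "\<forall>i\<in>{..n}. \<bar>poly P (x i)\<bar> * \<bar>lagrange_basis {..n} x i ?t\<bar> = 0"
    by (subst (asm) sum_nonneg_eq_0_iff) auto
  then have zero: "poly P (x i) = 0" if "i \<le> n" for i
    using abs_lagrange_basis_pos[OF dec below that] that by force
  show "P = 0"
    by (rule poly_eqI_degree[where A = "x ` {..n}"])
      (use zero deg decreasing_to_inj[OF dec] in \<open>auto simp: card_image\<close>)
qed

section \<open>Nodes interlacing a decreasing sequence of points\<close>

definition strictly_interlaced :: "nat \<Rightarrow> (nat \<Rightarrow> real) \<Rightarrow> (nat \<Rightarrow> real) \<Rightarrow> bool" where
  "strictly_interlaced n x a \<longleftrightarrow> (\<forall>i<n. x (Suc i) < a i \<and> a i < x i)"

lemma decreasing_toI_Suc: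
  assumes "\<And>i. i < n \<Longrightarrow> x (Suc i) < x i"
  shows "decreasing_to n x"
proof -
  have "i < k \<longrightarrow> k \<le> n \<longrightarrow> x k < x i" for i k
  proof (induction k)
    case (Suc k)
    then show ?case using assms[of k] by (cases "i = k") force+
  qed simp
  then show ?thesis by (simp add: decreasing_to_def)
qed

lemma strictly_interlaced_decreasing: "strictly_interlaced n x a \<Longrightarrow> decreasing_to n x"
  by (intro decreasing_toI_Suc) (force simp: strictly_interlaced_def)

lemma decreasing_toD_le: "decreasing_to n x \<Longrightarrow> i \<le> k \<Longrightarrow> k \<le> n \<Longrightarrow> x k \<le> x i"
  unfolding decreasing_to_def by (cases "i = k") (auto intro: less_imp_le)

lemma strictly_interlaced_inj:
  assumes "strictly_interlaced n x a"
  shows "inj_on a {..<n}"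
proof (rule linorder_inj_onI')
  fix i k assume "i \<in> {..<n}" "k \<in> {..<n}" "i < k"
  then have "a k < x k" "x k \<le> x (Suc i)" "x (Suc i) < a i"
    using assms decreasing_toD_le[OF strictly_interlaced_decreasing[OF assms], of "Suc i" k]
    by (auto simp: strictly_interlaced_def)
  then show "a i \<noteq> a k" by simp
qed

lemma root_poly_sign:
  assumes "strictly_interlaced n x a" and "i \<le> n"
  shows "0 < (-1) ^ i * poly (root_poly {..<n} a) (x i)"
proof -
  have dec: "decreasing_to n x" by (rule strictly_interlaced_decreasing) fact
  have "poly (root_poly {..<n} a) (x i) = (\<Prod>k<i. x i - a k) * (\<Prod>k\<in>{i..<n}. x i - a k)"
    unfolding poly_root_poly using assms(2)
    by (subst prod.union_disjoint[symmetric]) (auto intro: prod.cong)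
  also have "(\<Prod>k<i. x i - a k) = (-1) ^ i * (\<Prod>k<i. a k - x i)"
    using prod_uminus[of "\<lambda>k. a k - x i" "{..<i}"] by simp
  finally have "(-1) ^ i * poly (root_poly {..<n} a) (x i)
      = (\<Prod>k<i. a k - x i) * (\<Prod>k\<in>{i..<n}. x i - a k)"
    by (simp flip: power_mult_distrib mult.assoc)
  also have "\<dots> > 0"
  proof (intro mult_pos_pos prod_pos)
    fix k assume "k \<in> {..<i}"
    then have "x i \<le> x (Suc k)" "x (Suc k) < a k"
      using assms decreasing_toD_le[OF dec, of "Suc k" i] by (auto simp: strictly_interlaced_def)
    then show "0 < a k - x i" by simp
  next
    fix k assume "k \<in> {i..<n}"
    then have "a k < x k" "x k \<le> x i"
      using assms decreasing_toD_le[OF dec, of i k] by (auto simp: strictly_interlaced_def)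
    then show "0 < x i - a k" by simp
  qed
  finally show ?thesis .
qed

text \<open>The interpolant of alternating data changes sign in each gap; its \<open>n\<close> zeros exhaust its degree, so up
to a factor it is the polynomial with these zeros as nodes.  This is how new nodes are produced from
prescribed values.\<close>

lemma alternating_interpolation:
  assumes dec: "decreasing_to n x" and pos: "\<And>i. i \<le> n \<Longrightarrow> 0 < c i"
  shows "\<exists>a \<kappa>. strictly_interlaced n x a
    \<and> (\<forall>i\<le>n. \<kappa> * poly (root_poly {..<n} a) (x i) = (-1) ^ i * c i)"
proof -
  define P where "P = lagrange_poly {..n} x (\<lambda>i. (-1) ^ i * c i)"
  have val: "poly P (x i) = (-1) ^ i * c i" if "i \<le> n" for i
    unfolding P_def using that by (intro poly_lagrange_poly_node decreasing_to_inj[OF dec]) auto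
  have deg: "degree P \<le> n" unfolding P_def by (rule degree_lagrange_poly) auto
  have "\<exists>z>x (Suc i). z < x i \<and> poly P z = 0" if "i < n" for i
  proof (rule poly_IVT)
    show "x (Suc i) < x i" using dec that by (auto simp: decreasing_to_def)
    have "poly P (x (Suc i)) * poly P (x i) = - (((-1) ^ i * (-1) ^ i) * (c (Suc i) * c i))"
      using val[of "Suc i"] val[of i] that by simp
    also have "\<dots> < 0" using pos[of "Suc i"] pos[of i] that by (simp flip: power_mult_distrib)
    finally show "poly P (x (Suc i)) * poly P (x i) < 0" .
  qed
  then obtain a where a: "\<And>i. i < n \<Longrightarrow> x (Suc i) < a i \<and> a i < x i \<and> poly P (a i) = 0"
    by metis
  then have inter: "strictly_interlaced n x a" by (auto simp: strictly_interlaced_def)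
  define \<kappa> where "\<kappa> = poly P (x 0) / poly (root_poly {..<n} a) (x 0)"
  have ne0: "poly (root_poly {..<n} a) (x 0) \<noteq> 0" using root_poly_sign[OF inter, of 0] by auto
  have "P = smult \<kappa> (root_poly {..<n} a)"
  proof (rule poly_eqI_degree[where A = "insert (x 0) (a ` {..<n})"])
    have "poly (root_poly {..<n} a) (a i) = 0" if "i < n" for i
      unfolding poly_root_poly by (rule prod_zero) (use that in auto)
    then show "poly P z = poly (smult \<kappa> (root_poly {..<n} a)) z"
      if "z \<in> insert (x 0) (a ` {..<n})" for z
      using that a ne0 by (auto simp: \<kappa>_def)
    have "x 0 \<notin> a ` {..<n}"
    proof
      assume "x 0 \<in> a ` {..<n}"
      then obtain i where "i < n" "x 0 = a i" by auto
      then show False using a[of i] decreasing_toD_le[OF dec, of 0 i] by auto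
    qed
    then have card: "card (insert (x 0) (a ` {..<n})) = Suc n"
      using strictly_interlaced_inj[OF inter] by (simp add: card_image)
    then show "degree P < card (insert (x 0) (a ` {..<n}))" using deg by simp
    have "degree (smult \<kappa> (root_poly {..<n} a)) \<le> n"
      using degree_smult_le[of \<kappa> "root_poly {..<n} a"] by (simp add: degree_root_poly)
    then show "degree (smult \<kappa> (root_poly {..<n} a)) < card (insert (x 0) (a ` {..<n}))"
      unfolding card by simp
  qed
  then have "\<forall>i\<le>n. \<kappa> * poly (root_poly {..<n} a) (x i) = (-1) ^ i * c i"
    using val by (metis poly_smult)
  with inter show ?thesis by blast
qed

section \<open>The Zolotarev product and the power step\<close>

text \<open>The product of the Zolotarev problem after the substitution of \<open>- y\<close> for \<open>y\<close> and of \<open>- b\<close> for the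
second family of nodes.\<close>

definition zprod :: "nat \<Rightarrow> (nat \<Rightarrow> real) \<Rightarrow> (nat \<Rightarrow> real) \<Rightarrow> real \<Rightarrow> real \<Rightarrow> real" where
  "zprod n a b x y = (\<Prod>i<n. ((x - a i) * (y - b i)) / ((x + b i) * (y + a i)))"

lemma zprod_swap: "zprod n a b x y = zprod n b a y x"
  unfolding zprod_def by (simp add: mult.commute)

lemma abs_poly_root_poly_minus: "\<bar>poly (root_poly A a) (- t)\<bar> = \<bar>\<Prod>i\<in>A. t + a i\<bar>"
proof -
  have "\<bar>- t - a i\<bar> = \<bar>t + a i\<bar>" for i by (simp add: abs_if)
  then show ?thesis unfolding poly_root_poly abs_prod by simp
qed

lemma abs_zprod:
  "\<bar>zprod n a b x y\<bar> = (\<bar>poly (root_poly {..<n} a) x\<bar> * \<bar>poly (root_poly {..<n} b) y\<bar>)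
    / (\<bar>poly (root_poly {..<n} b) (- x)\<bar> * \<bar>poly (root_poly {..<n} a) (- y)\<bar>)"
  unfolding zprod_def abs_poly_root_poly_minus
  unfolding poly_root_poly
  by (simp add: prod_dividef prod.distrib abs_mult)

text \<open>Fix the points.  For polynomials alternating at them, interpolation from the \<open>x i\<close> to the \<open>- y j\<close>
and from the \<open>y j\<close> to the \<open>- x i\<close> acts on moduli by matrices \<open>A\<close> and \<open>B\<close> with positive entries.  The
hypotheses say that the vector of the \<open>\<bar>N\<^sub>b (- x i)\<bar>\<close> is not increased by \<open>\<mu> B A\<close>, where \<open>N\<^sub>b\<close> is
the polynomial with zeros \<open>b\<close>.  Prescribing these values for the new first polynomial, and the
resulting values at the \<open>- y j\<close> for the second, is one step of the power iteration for \<open>B A\<close>, and by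
positivity of \<open>A\<close> and \<open>B\<close> a strict inequality at one pair becomes strict at all pairs.\<close>

lemma power_step_improves:
  assumes a: "strictly_interlaced n x a" and b: "strictly_interlaced n y b"
    and sep: "\<And>i j. i \<le> n \<Longrightarrow> j \<le> n \<Longrightarrow> 0 < x i + y j"
    and ge: "\<And>i j. i \<le> n \<Longrightarrow> j \<le> n \<Longrightarrow> \<mu> \<le> \<bar>zprod n a b (x i) (y j)\<bar>"
    and strict: "i0 \<le> n" "j0 \<le> n" "\<mu> < \<bar>zprod n a b (x i0) (y j0)\<bar>"
  shows "\<exists>a' b'. strictly_interlaced n x a' \<and> strictly_interlaced n y b'
    \<and> (\<forall>i\<le>n. \<forall>j\<le>n. \<mu> < \<bar>zprod n a' b' (x i) (y j)\<bar>)"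
proof -
  let ?N = "\<lambda>a t. \<bar>poly (root_poly {..<n} a) t\<bar>"
  define A where "A j k = \<bar>lagrange_basis {..n} x k (- y j)\<bar>" for j k
  define B where "B i j = \<bar>lagrange_basis {..n} y j (- x i)\<bar>" for i j
  have x: "decreasing_to n x" and y: "decreasing_to n y"
    using a b strictly_interlaced_decreasing by auto
  have below_x: "- y j < x i" and below_y: "- x i < y j" if "i \<le> n" "j \<le> n" for i j
    using sep[OF that] by auto
  have A: "0 < A j k" if "j \<le> n" "k \<le> n" for j k
    unfolding A_def using that below_x by (intro abs_lagrange_basis_pos x) auto
  have B: "0 < B i j" if "i \<le> n" "j \<le> n" for i j
    unfolding B_def using that below_y by (intro abs_lagrange_basis_pos y) auto
  have deg: "degree (smult c (root_poly {..<n} a)) \<le> n" for c :: real and a :: "nat \<Rightarrow> real"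
    using degree_smult_le[of c "root_poly {..<n} a"] by (simp add: degree_root_poly)
  have Na: "?N a (- y j) = (\<Sum>k\<le>n. ?N a (x k) * A j k)" if "j \<le> n" for j
    unfolding A_def using that below_x root_poly_sign[OF a]
    by (intro alternating_abs_below x) (auto simp: degree_root_poly less_imp_le)
  have Nb: "?N b (- x i) = (\<Sum>j\<le>n. ?N b (y j) * B i j)" if "i \<le> n" for i
    unfolding B_def using that below_y root_poly_sign[OF b]
    by (intro alternating_abs_below y) (auto simp: degree_root_poly less_imp_le)
  have posa: "0 < ?N a (x i)" and posb: "0 < ?N b (y i)" if "i \<le> n" for i
    using root_poly_sign[OF a that] root_poly_sign[OF b that] by auto
  have posa': "0 < ?N a (- y j)" if "j \<le> n" for j
    unfolding Na[OF that] using posa A that by (intro sum_pos) auto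
  have posb': "0 < ?N b (- x i)" if "i \<le> n" for i
    unfolding Nb[OF that] using posb B that by (intro sum_pos) auto
  have ge': "\<mu> * (?N b (- x i) * ?N a (- y j)) \<le> ?N a (x i) * ?N b (y j)"
    if "i \<le> n" "j \<le> n" for i j
    using ge[OF that] mult_pos_pos[OF posb'[OF that(1)] posa'[OF that(2)]]
    unfolding abs_zprod by (subst (asm) pos_le_divide_eq) auto
  have strict': "\<mu> * (?N b (- x i0) * ?N a (- y j0)) < ?N a (x i0) * ?N b (y j0)"
    using strict(3) mult_pos_pos[OF posb'[OF strict(1)] posa'[OF strict(2)]]
    unfolding abs_zprod by (subst (asm) pos_less_divide_eq) auto
  \<comment> \<open>The new polynomials take the values \<open>?N b (- x k)\<close> at \<open>x k\<close> and \<open>D j\<close> at \<open>y j\<close>, up to sign;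
     the modulus of the first at \<open>- y j\<close> is \<open>D j\<close> as well.\<close>
  define D where "D j = (\<Sum>k\<le>n. ?N b (- x k) * A j k)" for j
  have D_pos: "0 < D j" if "j \<le> n" for j
    unfolding D_def using posb' A that by (intro sum_pos) auto
  have D_eq: "?N a (- y j) * (\<mu> * D j) = (\<Sum>k\<le>n. \<mu> * (?N b (- x k) * ?N a (- y j)) * A j k)" for j
    unfolding D_def sum_distrib_left by (simp add: mult_ac)
  have N_eq: "?N a (- y j) * ?N b (y j) = (\<Sum>k\<le>n. ?N a (x k) * ?N b (y j) * A j k)"
    if "j \<le> n" for j
    unfolding Na[OF that] sum_distrib_right by (simp add: mult_ac)
  have D_le: "\<mu> * D j \<le> ?N b (y j)" if j: "j \<le> n" for j
  proof (rule mult_left_le_imp_le[OF _ posa'[OF j]])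
    show "?N a (- y j) * (\<mu> * D j) \<le> ?N a (- y j) * ?N b (y j)"
      unfolding D_eq N_eq[OF j] using ge' j A
      by (intro sum_mono mult_right_mono) (auto simp: less_imp_le)
  qed
  have D_less: "\<mu> * D j0 < ?N b (y j0)"
  proof (rule mult_left_less_imp_less[OF _ less_imp_le[OF posa'[OF strict(2)]]])
    show "?N a (- y j0) * (\<mu> * D j0) < ?N a (- y j0) * ?N b (y j0)"
      unfolding D_eq N_eq[OF strict(2)] using ge' strict' strict A
      by (intro sum_strict_mono_ex1)
        (auto intro!: mult_right_mono mult_strict_right_mono bexI[of _ i0] simp: less_imp_le)
  qed
  obtain a' \<kappa> where a': "strictly_interlaced n x a'"
    and \<kappa>: "\<And>i. i \<le> n \<Longrightarrow> \<kappa> * poly (root_poly {..<n} a') (x i) = (-1) ^ i * ?N b (- x i)"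
    using alternating_interpolation[OF x, of "\<lambda>i. ?N b (- x i)"] posb' by blast
  obtain b' \<tau> where b': "strictly_interlaced n y b'"
    and \<tau>: "\<And>j. j \<le> n \<Longrightarrow> \<tau> * poly (root_poly {..<n} b') (y j) = (-1) ^ j * D j"
    using alternating_interpolation[OF y, of D] D_pos by blast
  have Nx: "\<bar>\<kappa>\<bar> * ?N a' (x i) = ?N b (- x i)" if "i \<le> n" for i
    using arg_cong[OF \<kappa>[OF that], of abs] by (simp add: abs_mult power_abs)
  have Ny: "\<bar>\<tau>\<bar> * ?N b' (y j) = D j" if "j \<le> n" for j
    using arg_cong[OF \<tau>[OF that], of abs] D_pos[OF that] by (simp add: abs_mult power_abs)
  have Na': "\<bar>\<kappa>\<bar> * ?N a' (- y j) = D j" if "j \<le> n" for j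
  proof -
    have "\<bar>poly (smult \<kappa> (root_poly {..<n} a')) (- y j)\<bar>
        = (\<Sum>k\<le>n. \<bar>poly (smult \<kappa> (root_poly {..<n} a')) (x k)\<bar> * A j k)"
      unfolding A_def
      by (rule alternating_abs_below[OF x _ deg]) (use that below_x \<kappa> in auto)
    then show ?thesis using Nx by (simp add: abs_mult D_def)
  qed
  have Nb': "\<bar>\<tau>\<bar> * ?N b' (- x i) = (\<Sum>j\<le>n. D j * B i j)" if "i \<le> n" for i
  proof -
    have "\<bar>poly (smult \<tau> (root_poly {..<n} b')) (- x i)\<bar>
        = (\<Sum>j\<le>n. \<bar>poly (smult \<tau> (root_poly {..<n} b')) (y j)\<bar> * B i j)"
      unfolding B_def
      by (rule alternating_abs_below[OF y _ deg]) (use that below_y \<tau> D_pos in \<open>auto simp: less_imp_le\<close>)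
    then show ?thesis using Ny by (simp add: abs_mult)
  qed
  have less: "\<mu> * (\<bar>\<tau>\<bar> * ?N b' (- x i)) < ?N b (- x i)" if i: "i \<le> n" for i
  proof -
    have "\<mu> * (\<bar>\<tau>\<bar> * ?N b' (- x i)) = (\<Sum>j\<le>n. (\<mu> * D j) * B i j)"
      unfolding Nb'[OF i] sum_distrib_left by (simp add: mult_ac)
    also have "\<dots> < (\<Sum>j\<le>n. ?N b (y j) * B i j)"
      using D_le D_less strict B i
      by (intro sum_strict_mono_ex1)
        (auto intro!: mult_right_mono mult_strict_right_mono bexI[of _ j0] simp: less_imp_le)
    finally show ?thesis unfolding Nb[OF i] .
  qed
  have "\<mu> < \<bar>zprod n a' b' (x i) (y j)\<bar>" if ij: "i \<le> n" "j \<le> n" for i j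
  proof -
    have Nb'_pos: "0 < \<bar>\<tau>\<bar> * ?N b' (- x i)"
      unfolding Nb'[OF ij(1)] using D_pos B ij by (intro sum_pos) auto
    have nz: "\<kappa> \<noteq> 0" "\<tau> \<noteq> 0" using Nx[OF ij(1)] posb'[OF ij(1)] Nb'_pos by auto
    have "\<bar>zprod n a' b' (x i) (y j)\<bar>
        = ((\<bar>\<kappa>\<bar> * ?N a' (x i)) * (\<bar>\<tau>\<bar> * ?N b' (y j)))
          / ((\<bar>\<tau>\<bar> * ?N b' (- x i)) * (\<bar>\<kappa>\<bar> * ?N a' (- y j)))"
      unfolding abs_zprod using nz by simp
    also have "\<dots> = ?N b (- x i) / (\<bar>\<tau>\<bar> * ?N b' (- x i))"
      unfolding Nx[OF ij(1)] Ny[OF ij(2)] Na'[OF ij(2)] using D_pos[OF ij(2)] by simp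
    also have "\<mu> < \<dots>"
      using less[OF ij(1)] Nb'_pos by (subst pos_less_divide_eq) auto
    finally show ?thesis .
  qed
  with a' b' show ?thesis by blast
qed

section \<open>Existence of an equioscillation\<close>

text \<open>Weak inequalities keep the family of configurations closed; at configurations with nonzero products
the interlacing is strict anyway.\<close>

definition interlaced_in :: "nat \<Rightarrow> real set \<Rightarrow> (nat \<Rightarrow> real) \<Rightarrow> (nat \<Rightarrow> real) \<Rightarrow> bool" where
  "interlaced_in n X x a \<longleftrightarrow> (\<forall>i\<le>n. x i \<in> X) \<and> (\<forall>i<n. x (Suc i) \<le> a i \<and> a i \<le> x i)"

lemma compact_interlaced_in:
  assumes "compact X"
  shows "compact {(x, a). (\<forall>i. \<bar>x i\<bar> \<le> M) \<and> (\<forall>i. \<bar>a i\<bar> \<le> M) \<and> interlaced_in n X x a}"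
proof -
  have box: "compact {x :: nat \<Rightarrow> real. \<forall>i. \<bar>x i\<bar> \<le> M}"
  proof -
    have "compactin (product_topology (\<lambda>i. euclidean) UNIV) (PiE UNIV (\<lambda>i :: nat. {-M..M}))"
      by (subst compactin_PiE) auto
    moreover have "PiE UNIV (\<lambda>i :: nat. {-M..M}) = {x. \<forall>i. \<bar>x i\<bar> \<le> M}"
      by (auto simp: PiE_def Pi_def abs_le_iff) (metis minus_le_iff)+
    ultimately show ?thesis by (simp add: euclidean_product_topology)
  qed
  have coord: "continuous_on UNIV (\<lambda>p :: (nat \<Rightarrow> real) \<times> (nat \<Rightarrow> real). fst p i)"
      "continuous_on UNIV (\<lambda>p :: (nat \<Rightarrow> real) \<times> (nat \<Rightarrow> real). snd p i)" for i
    by (rule continuous_on_product_then_coordinatewise, rule continuous_intros, rule continuous_on_id)+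
  have X: "closed {p :: (nat \<Rightarrow> real) \<times> (nat \<Rightarrow> real). fst p i \<in> X}" for i
    using closed_vimage[OF compact_imp_closed[OF assms] coord(1)] by (simp add: vimage_def)
  have "closed {p. (\<forall>i. i \<le> n \<longrightarrow> fst p i \<in> X)
      \<and> (\<forall>i. i < n \<longrightarrow> fst p (Suc i) \<le> snd p i \<and> snd p i \<le> fst p i)}"
    by (intro closed_Collect_conj closed_Collect_all closed_Collect_imp open_Collect_const X
        closed_Collect_le coord)
  from compact_Int_closed[OF compact_Times[OF box box] this]
  show ?thesis
    by (rule back_subst[of compact]) (auto simp: interlaced_in_def)
qed

lemma continuous_on_Min_family:
  fixes f :: "'i \<Rightarrow> 'a::topological_space \<Rightarrow> real"
  assumes "finite F" and "F \<noteq> {}" and "\<And>k. k \<in> F \<Longrightarrow> continuous_on S (f k)"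
  shows "continuous_on S (\<lambda>p. Min ((\<lambda>k. f k p) ` F))"
  using assms
proof (induction F rule: finite_ne_induct)
  case (insert k F)
  then show ?case by (auto intro!: continuous_on_min)
qed simp

lemma interlaced_maximizer:
  assumes "compact X" and "compact Y" and sep: "\<And>x y. x \<in> X \<Longrightarrow> y \<in> Y \<Longrightarrow> 0 < x + y"
    and x0: "interlaced_in n X x0 a0" and y0: "interlaced_in n Y y0 b0"
  shows "\<exists>x a y b \<mu>. interlaced_in n X x a \<and> interlaced_in n Y y b
    \<and> (\<forall>i\<le>n. \<forall>j\<le>n. \<mu> \<le> \<bar>zprod n a b (x i) (y j)\<bar>)
    \<and> (\<exists>i\<le>n. \<exists>j\<le>n. \<bar>zprod n a b (x i) (y j)\<bar> = \<mu>)
    \<and> (\<forall>x' a' y' b'. interlaced_in n X x' a' \<longrightarrow> interlaced_in n Y y' b'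
        \<longrightarrow> (\<exists>i\<le>n. \<exists>j\<le>n. \<bar>zprod n a' b' (x' i) (y' j)\<bar> \<le> \<mu>))"
proof -
  obtain M where M: "\<And>z. z \<in> X \<union> Y \<Longrightarrow> \<bar>z\<bar> \<le> M"
    using compact_imp_bounded[OF compact_Un[OF assms(1,2)]] unfolding bounded_iff by auto
  have "x0 0 \<in> X" using x0 by (simp add: interlaced_in_def)
  then have M0: "0 \<le> M" using M[of "x0 0"] by simp
  define C where "C X = {(x, a). (\<forall>i. \<bar>x i\<bar> \<le> M) \<and> (\<forall>i. \<bar>a i\<bar> \<le> M) \<and> interlaced_in n X x a}" for X
  define \<Phi> where "\<Phi> p = Min ((\<lambda>k. \<bar>zprod n (snd (fst p)) (snd (snd p))
      (fst (fst p) (fst k)) (fst (snd p) (snd k))\<bar>) ` ({..n} \<times> {..n}))"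
    for p :: "((nat \<Rightarrow> real) \<times> (nat \<Rightarrow> real)) \<times> ((nat \<Rightarrow> real) \<times> (nat \<Rightarrow> real))"
  \<comment> \<open>Only the entries up to \<open>n\<close> matter; setting the others to 0 brings a configuration into \<open>C\<close>.\<close>
  define cut where "cut m x = (\<lambda>i. if i < m then x i else 0)" for m and x :: "nat \<Rightarrow> real"
  have in_C: "(cut (Suc n) x, cut n a) \<in> C Z" if "interlaced_in n Z x a" "Z \<subseteq> X \<union> Y" for x a Z
  proof -
    have xM: "\<bar>x i\<bar> \<le> M" if "i \<le> n" for i
      using that \<open>interlaced_in n Z x a\<close> \<open>Z \<subseteq> X \<union> Y\<close> M by (auto simp: interlaced_in_def)
    have aM: "\<bar>a i\<bar> \<le> M" if "i < n" for i
    proof -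
      have "x (Suc i) \<le> a i" "a i \<le> x i"
        using \<open>interlaced_in n Z x a\<close> that by (auto simp: interlaced_in_def)
      then show ?thesis using xM[of i] xM[of "Suc i"] that by simp
    qed
    have "interlaced_in n Z (cut (Suc n) x) (cut n a)"
      using that(1) by (simp add: interlaced_in_def cut_def)
    moreover have "\<bar>cut (Suc n) x i\<bar> \<le> M" "\<bar>cut n a i\<bar> \<le> M" for i
      using M0 xM[of i] aM[of i] by (simp_all add: cut_def)
    ultimately show ?thesis by (simp add: C_def)
  qed
  have zcut: "zprod n (cut n a) (cut n b) = zprod n a b" for a b
    by (rule ext, rule ext) (simp add: zprod_def cut_def)
  have \<Phi>cut: "\<Phi> ((cut (Suc n) x, cut n a), (cut (Suc n) y, cut n b)) = \<Phi> ((x, a), (y, b))" for x a y b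
    unfolding \<Phi>_def by (rule arg_cong[where f = Min], rule image_cong) (auto simp: zcut, auto simp: cut_def)
  have "compact (C X \<times> C Y)"
    unfolding C_def by (intro compact_Times compact_interlaced_in assms)
  moreover have "C X \<times> C Y \<noteq> {}" using in_C[OF x0] in_C[OF y0] by auto
  moreover have "continuous_on (C X \<times> C Y) \<Phi>"
    unfolding \<Phi>_def
  proof (rule continuous_on_Min_family)
    fix k :: "nat \<times> nat" assume k: "k \<in> {..n} \<times> {..n}"
    have pos: "0 < fst (fst p) (fst k) + snd (snd p) l \<and> 0 < fst (snd p) (snd k) + snd (fst p) l"
      if "p \<in> C X \<times> C Y" "l < n" for p l
    proof -
      have "interlaced_in n X (fst (fst p)) (snd (fst p))" "interlaced_in n Y (fst (snd p)) (snd (snd p))"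
        using that by (auto simp: C_def)
      then have "fst (fst p) (fst k) \<in> X" "fst (fst p) (Suc l) \<in> X" "fst (fst p) (Suc l) \<le> snd (fst p) l"
        "fst (snd p) (snd k) \<in> Y" "fst (snd p) (Suc l) \<in> Y" "fst (snd p) (Suc l) \<le> snd (snd p) l"
        using k \<open>l < n\<close> by (auto simp: interlaced_in_def)
      then show ?thesis
        using sep[of "fst (fst p) (fst k)" "fst (snd p) (Suc l)"]
          sep[of "fst (fst p) (Suc l)" "fst (snd p) (snd k)"] by simp
    qed
    have coord: "continuous_on (C X \<times> C Y) (\<lambda>p. fst (fst p) i)" "continuous_on (C X \<times> C Y) (\<lambda>p. snd (fst p) i)"
      "continuous_on (C X \<times> C Y) (\<lambda>p. fst (snd p) i)" "continuous_on (C X \<times> C Y) (\<lambda>p. snd (snd p) i)" for i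
      by (rule continuous_on_product_then_coordinatewise, intro continuous_intros)+
    show "continuous_on (C X \<times> C Y) (\<lambda>p. \<bar>zprod n (snd (fst p)) (snd (snd p))
      (fst (fst p) (fst k)) (fst (snd p) (snd k))\<bar>)"
      unfolding zprod_def
    proof (intro continuous_intros coord ballI)
      fix l p assume "l \<in> {..<n}" "p \<in> C X \<times> C Y"
      with pos[of p l]
      show "(fst (fst p) (fst k) + snd (snd p) l) * (fst (snd p) (snd k) + snd (fst p) l) \<noteq> 0" by simp
    qed
  qed auto
  ultimately have "\<exists>p\<in>C X \<times> C Y. \<forall>q\<in>C X \<times> C Y. \<Phi> q \<le> \<Phi> p"
    by (rule continuous_attains_sup)
  then obtain p where p: "p \<in> C X \<times> C Y" and max: "\<And>q. q \<in> C X \<times> C Y \<Longrightarrow> \<Phi> q \<le> \<Phi> p"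
    by metis
  obtain x a y b where p_eq: "p = ((x, a), (y, b))" by (cases p) auto
  have fin: "finite ((\<lambda>k. \<bar>zprod n a b (x (fst k)) (y (snd k))\<bar>) ` ({..n} \<times> {..n}))"
    "(\<lambda>k. \<bar>zprod n a b (x (fst k)) (y (snd k))\<bar>) ` ({..n} \<times> {..n}) \<noteq> {}" for a b x y by auto
  have le: "\<Phi> ((x, a), (y, b)) \<le> \<bar>zprod n a b (x i) (y j)\<bar>" if "i \<le> n" "j \<le> n" for x a y b i j
    unfolding \<Phi>_def fst_conv snd_conv by (rule Min_le[OF fin(1)], rule image_eqI[of _ _ "(i, j)"]) (use that in auto)
  have att: "\<exists>i\<le>n. \<exists>j\<le>n. \<bar>zprod n a b (x i) (y j)\<bar> = \<Phi> ((x, a), (y, b))" for x a y b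
  proof -
    have "\<Phi> ((x, a), (y, b)) \<in> (\<lambda>k. \<bar>zprod n a b (x (fst k)) (y (snd k))\<bar>) ` ({..n} \<times> {..n})"
      unfolding \<Phi>_def fst_conv snd_conv by (rule Min_in[OF fin])
    then obtain k where "k \<in> {..n} \<times> {..n}"
      "\<Phi> ((x, a), (y, b)) = \<bar>zprod n a b (x (fst k)) (y (snd k))\<bar>" by (rule imageE) simp
    then show ?thesis by (intro exI[of _ "fst k"] exI[of _ "snd k"]) auto
  qed
  have "\<exists>i\<le>n. \<exists>j\<le>n. \<bar>zprod n a' b' (x' i) (y' j)\<bar> \<le> \<Phi> p"
    if "interlaced_in n X x' a'" "interlaced_in n Y y' b'" for x' a' y' b'
  proof -
    have "((cut (Suc n) x', cut n a'), (cut (Suc n) y', cut n b')) \<in> C X \<times> C Y"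
      using in_C[OF that(1)] in_C[OF that(2)] by simp
    from max[OF this] have "\<Phi> ((x', a'), (y', b')) \<le> \<Phi> p" unfolding \<Phi>cut .
    moreover obtain i j where "i \<le> n" "j \<le> n" "\<bar>zprod n a' b' (x' i) (y' j)\<bar> = \<Phi> ((x', a'), (y', b'))"
      using att by blast
    ultimately show ?thesis by metis
  qed
  moreover have "interlaced_in n X x a" "interlaced_in n Y y b" using p p_eq by (simp_all add: C_def)
  moreover have "\<forall>i\<le>n. \<forall>j\<le>n. \<Phi> p \<le> \<bar>zprod n a b (x i) (y j)\<bar>"
    unfolding p_eq using le by simp
  moreover have "\<exists>i\<le>n. \<exists>j\<le>n. \<bar>zprod n a b (x i) (y j)\<bar> = \<Phi> p"
    unfolding p_eq by (rule att)
  ultimately show ?thesis by (intro exI[of _ x] exI[of _ a] exI[of _ y] exI[of _ b] exI[of _ "\<Phi> p"]) simp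
qed

text \<open>The exchange step: the nodes cut the line into \<open>n + 1\<close> cells with one point \<open>x i\<close> in each, and any
point may take the place of the one in its cell.  No signs need to be followed.\<close>

lemma interlaced_cell:
  assumes "interlaced_in n X x a" and "u \<in> X"
  shows "\<exists>i\<le>n. interlaced_in n X (x(i := u)) a"
proof -
  define i where "i = (LEAST i. i = n \<or> a i \<le> u)"
  have i: "i = n \<or> a i \<le> u" unfolding i_def by (rule LeastI[of _ n]) simp
  have "i \<le> n" unfolding i_def by (rule Least_le) simp
  moreover have "u < a k" if "Suc k = i" for k
    using not_less_Least[of k "\<lambda>i. i = n \<or> a i \<le> u"] that unfolding i_def by auto
  ultimately show ?thesis
    using assms i by (intro exI[of _ i]) (auto simp: interlaced_in_def less_imp_le)
qed

lemma strictly_interlaced_if_nonzero: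
  assumes "interlaced_in n X x a" and "\<And>i. i \<le> n \<Longrightarrow> poly (root_poly {..<n} a) (x i) \<noteq> 0"
  shows "strictly_interlaced n x a"
  unfolding strictly_interlaced_def
proof (intro allI impI)
  fix i assume i: "i < n"
  have "x i \<noteq> a i" "x (Suc i) \<noteq> a i"
    using assms(2)[of i] assms(2)[of "Suc i"] i by (auto simp: poly_root_poly)
  then show "x (Suc i) < a i \<and> a i < x i"
    using assms(1) i by (simp add: interlaced_in_def less_le)
qed

text \<open>The modulus of the product splits into a function of \<open>x\<close> and a function of \<open>y\<close>.  Hence if it is not
zero at \<open>(x, y)\<close> and larger at \<open>(u, v)\<close>, then already exchanging one of the two arguments enlarges it.\<close>

definition zfactor :: "nat \<Rightarrow> (nat \<Rightarrow> real) \<Rightarrow> (nat \<Rightarrow> real) \<Rightarrow> real \<Rightarrow> real" where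
  "zfactor n a b t = \<bar>poly (root_poly {..<n} a) t\<bar> / \<bar>poly (root_poly {..<n} b) (- t)\<bar>"

lemma abs_zprod_factor: "\<bar>zprod n a b x y\<bar> = zfactor n a b x * zfactor n b a y"
  unfolding abs_zprod zfactor_def by simp

lemma zfactor_nonneg: "0 \<le> zfactor n a b t"
  by (simp add: zfactor_def)

definition equioscillation ::
  "nat \<Rightarrow> (nat \<Rightarrow> real) \<Rightarrow> (nat \<Rightarrow> real) \<Rightarrow> (nat \<Rightarrow> real) \<Rightarrow> (nat \<Rightarrow> real) \<Rightarrow> real \<Rightarrow> bool" where
  "equioscillation n x a y b \<mu> \<longleftrightarrow>
    strictly_interlaced n x a \<and> strictly_interlaced n y b
    \<and> (\<forall>i\<le>n. \<forall>j\<le>n. 0 < x i + y j)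
    \<and> 0 < \<mu> \<and> (\<forall>i\<le>n. \<forall>j\<le>n. \<bar>zprod n a b (x i) (y j)\<bar> = \<mu>)"

lemma equioscillationD:
  assumes "equioscillation n x a y b \<mu>"
  shows "strictly_interlaced n x a" and "strictly_interlaced n y b"
    and "i \<le> n \<Longrightarrow> j \<le> n \<Longrightarrow> 0 < x i + y j" and "0 < \<mu>"
    and "i \<le> n \<Longrightarrow> j \<le> n \<Longrightarrow> \<bar>zprod n a b (x i) (y j)\<bar> = \<mu>"
  using assms by (simp_all add: equioscillation_def)

lemma equioscillation_swap: "equioscillation n x a y b \<mu> \<Longrightarrow> equioscillation n y b x a \<mu>"
  unfolding equioscillation_def by (simp add: zprod_swap[of n a b] add.commute)

text \<open>At a maximiser of the least modulus the power step is impossible, so no product at the points exceeds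
the minimum; by the exchange step this extends from the points to all of \<open>X\<close> and \<open>Y\<close>.\<close>

theorem equioscillation_exists:
  assumes "compact X" and "compact Y" and sep: "\<And>x y. x \<in> X \<Longrightarrow> y \<in> Y \<Longrightarrow> 0 < x + y"
    and x0: "decreasing_to n x0" "\<And>i. i \<le> n \<Longrightarrow> x0 i \<in> X"
    and y0: "decreasing_to n y0" "\<And>i. i \<le> n \<Longrightarrow> y0 i \<in> Y"
  shows "\<exists>x a y b \<mu>. equioscillation n x a y b \<mu>
    \<and> (\<forall>i\<le>n. x i \<in> X) \<and> (\<forall>i\<le>n. y i \<in> Y)
    \<and> (\<forall>x\<in>X. \<forall>y\<in>Y. \<bar>zprod n a b x y\<bar> \<le> \<mu>)"
proof -
  have sep0: "0 < x i + y j" if "\<forall>i\<le>n. x i \<in> X" "\<forall>i\<le>n. y i \<in> Y" "i \<le> n" "j \<le> n"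
    for i j and x y :: "nat \<Rightarrow> real"
    using that sep by blast
  obtain a0 \<kappa> where a0: "strictly_interlaced n x0 a0"
    using alternating_interpolation[OF x0(1), of "\<lambda>_. 1"] by auto
  obtain b0 \<tau> where b0: "strictly_interlaced n y0 b0"
    using alternating_interpolation[OF y0(1), of "\<lambda>_. 1"] by auto
  have X0: "interlaced_in n X x0 a0" "interlaced_in n Y y0 b0"
    using a0 b0 x0 y0 by (auto simp: interlaced_in_def strictly_interlaced_def less_imp_le)
  obtain x a y b \<mu> where xa: "interlaced_in n X x a" and yb: "interlaced_in n Y y b"
    and ge: "\<And>i j. i \<le> n \<Longrightarrow> j \<le> n \<Longrightarrow> \<mu> \<le> \<bar>zprod n a b (x i) (y j)\<bar>"
    and att: "\<exists>i\<le>n. \<exists>j\<le>n. \<bar>zprod n a b (x i) (y j)\<bar> = \<mu>"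
    and max: "\<And>x' a' y' b'. interlaced_in n X x' a' \<Longrightarrow> interlaced_in n Y y' b'
        \<Longrightarrow> \<exists>i\<le>n. \<exists>j\<le>n. \<bar>zprod n a' b' (x' i) (y' j)\<bar> \<le> \<mu>"
    using interlaced_maximizer[OF assms(1-3) X0] by blast
  have \<mu>: "0 < \<mu>"
  proof -
    obtain i j where ij: "i \<le> n" "j \<le> n" "\<bar>zprod n a0 b0 (x0 i) (y0 j)\<bar> \<le> \<mu>" using max[OF X0] by blast
    have nz: "poly (root_poly {..<n} a0) (x0 i) \<noteq> 0" "poly (root_poly {..<n} b0) (y0 j) \<noteq> 0"
      using root_poly_sign[OF a0 ij(1)] root_poly_sign[OF b0 ij(2)] by auto
    have "poly (root_poly {..<n} b0) (- x0 i) \<noteq> 0" "poly (root_poly {..<n} a0) (- y0 j) \<noteq> 0"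
    proof -
      have "- x0 i - b0 k \<noteq> 0" "- y0 j - a0 k \<noteq> 0" if "k < n" for k
        using sep0[of x0 y0 i "Suc k"] sep0[of x0 y0 "Suc k" j] x0(2) y0(2) ij a0 b0 that
        by (force simp: strictly_interlaced_def)+
      then show "poly (root_poly {..<n} b0) (- x0 i) \<noteq> 0" "poly (root_poly {..<n} a0) (- y0 j) \<noteq> 0"
        unfolding poly_root_poly by auto
    qed
    with nz have "0 < \<bar>zprod n a0 b0 (x0 i) (y0 j)\<bar>" unfolding abs_zprod by simp
    with ij(3) show ?thesis by simp
  qed
  \<comment> \<open>Otherwise the power step would give nodes with all products above the maximum \<open>\<mu>\<close>.\<close>
  have no_excess: False if inter: "interlaced_in n X x' a" "interlaced_in n Y y' b"
    and ge': "\<And>i j. i \<le> n \<Longrightarrow> j \<le> n \<Longrightarrow> \<mu> \<le> \<bar>zprod n a b (x' i) (y' j)\<bar>"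
    and above: "i \<le> n" "j \<le> n" "\<mu> < \<bar>zprod n a b (x' i) (y' j)\<bar>" for x' y' i j
  proof -
    have nz: "poly (root_poly {..<n} a) (x' i) \<noteq> 0" "poly (root_poly {..<n} b) (y' i) \<noteq> 0"
      if "i \<le> n" for i
      using ge'[OF that that] \<mu> unfolding abs_zprod by auto
    have s: "strictly_interlaced n x' a" "strictly_interlaced n y' b"
      using strictly_interlaced_if_nonzero inter nz by blast+
    have mem: "\<forall>i\<le>n. x' i \<in> X" "\<forall>i\<le>n. y' i \<in> Y"
      using inter by (auto simp: interlaced_in_def)
    obtain a' b' where ab': "strictly_interlaced n x' a'" "strictly_interlaced n y' b'"
      "\<forall>i\<le>n. \<forall>j\<le>n. \<mu> < \<bar>zprod n a' b' (x' i) (y' j)\<bar>"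
      using power_step_improves[OF s sep0[OF mem] ge' above] by blast
    then have "interlaced_in n X x' a'" "interlaced_in n Y y' b'"
      using mem by (auto simp: interlaced_in_def strictly_interlaced_def less_imp_le)
    from max[OF this] ab'(3) show False by force
  qed
  have le: "\<bar>zprod n a b u v\<bar> \<le> \<mu>" if uv: "u \<in> X" "v \<in> Y" for u v
  proof (rule ccontr)
    assume "\<not> \<bar>zprod n a b u v\<bar> \<le> \<mu>"
    moreover obtain i0 j0 where ij0: "i0 \<le> n" "j0 \<le> n" "\<bar>zprod n a b (x i0) (y j0)\<bar> = \<mu>"
      using att by blast
    ultimately have "zfactor n a b (x i0) * zfactor n b a (y j0) < zfactor n a b u * zfactor n b a v"
      by (simp add: abs_zprod_factor)
    then consider "zfactor n a b (x i0) < zfactor n a b u" | "zfactor n b a (y j0) < zfactor n b a v"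
      by (meson mult_mono' not_le zfactor_nonneg)
    then show False
    proof cases
      case 1
      obtain i where i: "i \<le> n" "interlaced_in n X (x(i := u)) a"
        using interlaced_cell[OF xa uv(1)] by blast
      have gt: "\<mu> < \<bar>zprod n a b u (y j)\<bar>" if "j \<le> n" for j
      proof -
        have "0 < zfactor n b a (y j)"
          using ge[OF ij0(1) that] \<mu> zfactor_nonneg[of n b a "y j"]
          by (cases "zfactor n b a (y j) = 0") (auto simp: abs_zprod_factor)
        then have "\<bar>zprod n a b (x i0) (y j)\<bar> < \<bar>zprod n a b u (y j)\<bar>"
          unfolding abs_zprod_factor using 1 by simp
        with ge[OF ij0(1) that] show ?thesis by simp
      qed
      show False
        by (rule no_excess[OF i(2) yb _ i(1), of 0]) (use ge gt in \<open>auto simp: less_imp_le\<close>)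
    next
      case 2
      obtain j where j: "j \<le> n" "interlaced_in n Y (y(j := v)) b"
        using interlaced_cell[OF yb uv(2)] by blast
      have gt: "\<mu> < \<bar>zprod n a b (x i) v\<bar>" if "i \<le> n" for i
      proof -
        have "0 < zfactor n a b (x i)"
          using ge[OF that ij0(2)] \<mu> zfactor_nonneg[of n a b "x i"]
          by (cases "zfactor n a b (x i) = 0") (auto simp: abs_zprod_factor)
        then have "\<bar>zprod n a b (x i) (y j0)\<bar> < \<bar>zprod n a b (x i) v\<bar>"
          unfolding abs_zprod_factor using 2 by simp
        with ge[OF that ij0(2)] show ?thesis by simp
      qed
      show False
        by (rule no_excess[OF xa j(2) _ _ j(1), of 0]) (use ge gt in \<open>auto simp: less_imp_le\<close>)
    qed
  qed
  have mem: "\<forall>i\<le>n. x i \<in> X" "\<forall>i\<le>n. y i \<in> Y"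
    using xa yb by (auto simp: interlaced_in_def)
  have nz: "poly (root_poly {..<n} a) (x i) \<noteq> 0" "poly (root_poly {..<n} b) (y i) \<noteq> 0"
    if "i \<le> n" for i
    using ge[OF that that] \<mu> unfolding abs_zprod by auto
  have "strictly_interlaced n x a" "strictly_interlaced n y b"
    using strictly_interlaced_if_nonzero xa yb nz by blast+
  moreover have "\<bar>zprod n a b (x i) (y j)\<bar> = \<mu>" if "i \<le> n" "j \<le> n" for i j
    using le[of "x i" "y j"] ge[OF that] mem that by (simp add: antisym)
  ultimately have "equioscillation n x a y b \<mu>"
    using sep0[OF mem] \<mu> by (simp add: equioscillation_def)
  with mem le show ?thesis by blast
qed

section \<open>Nodes as good as an equioscillation are distinct\<close>

lemma poly_root_poly_minus:
  "poly (root_poly {..<n} a) (- t) = (-1) ^ n * (\<Prod>i<n. t + a i)"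
proof -
  have "poly (root_poly {..<n} a) (- t) = (\<Prod>i<n. - (t + a i))"
    unfolding poly_root_poly by (rule prod.cong) auto
  also have "\<dots> = (-1) ^ n * (\<Prod>i<n. t + a i)" by (subst prod_uminus) simp
  finally show ?thesis .
qed

lemma abs_root_poly_eq_zfactor:
  assumes "\<And>k. k < n \<Longrightarrow> 0 < t + b k"
  shows "\<bar>poly (root_poly {..<n} a) t\<bar> = zfactor n a b t * (\<Prod>i<n. t + b i)"
proof -
  have "0 < (\<Prod>i<n. t + b i)" using assms by (intro prod_pos) auto
  then show ?thesis by (simp add: zfactor_def abs_poly_root_poly_minus del: prod_zero_iff)
qed

text \<open>Let \<open>N\<^sub>c\<close> be the polynomial with zeros \<open>c k\<close> and \<open>E\<^sub>c\<close> the one with zeros \<open>- c k\<close>.  After scaling by a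
suitable \<open>s\<close>, the rational function \<open>N\<^sub>a\<^sub>' / E\<^sub>b\<^sub>'\<close> is dominated at the \<open>x i\<close> by \<open>s N\<^sub>a / E\<^sub>b\<close>, and
the reciprocals are dominated likewise at the \<open>- y j\<close>.  Therefore the numerator of the difference
alternates along \<open>x 0 > \<dots> > x n > - y n > \<dots> > - y 0\<close>, which is one point too many for its degree
\<open>2 n\<close>.  So it vanishes, and every \<open>a k\<close> occurs among the \<open>a' k\<close>.  By symmetry the same holds for
\<open>b'\<close>.\<close>

theorem equioscillation_forces_distinct_nodes:
  assumes equi: "equioscillation n x a y b \<mu>"
    and sep': "\<And>i k. i \<le> n \<Longrightarrow> k < n \<Longrightarrow> 0 < x i + b' k" "\<And>j k. j \<le> n \<Longrightarrow> k < n \<Longrightarrow> 0 < y j + a' k"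
    and le: "\<And>i j. i \<le> n \<Longrightarrow> j \<le> n \<Longrightarrow> \<bar>zprod n a' b' (x i) (y j)\<bar> \<le> \<mu>"
  shows "inj_on a' {..<n}"
proof -
  note xa = equioscillationD(1)[OF equi] and yb = equioscillationD(2)[OF equi]
    and sep = equioscillationD(3)[OF equi] and \<mu> = equioscillationD(4,5)[OF equi]
  let ?N = "\<lambda>a. root_poly {..<n} a"
  define e where "e a t = (\<Prod>i<n. t + a i)" for a and t :: real
  have xb: "0 < x i + b k" if "i \<le> n" "k < n" for i k
    using sep[of i "Suc k"] yb that by (force simp: strictly_interlaced_def)
  have ya: "0 < y j + a k" if "j \<le> n" "k < n" for j k
    using sep[of "Suc k" j] xa that by (force simp: strictly_interlaced_def)
  have e: "0 < e b (x i)" "0 < e b' (x i)" "0 < e a (y i)" "0 < e a' (y i)" if "i \<le> n" for i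
    unfolding e_def using xb ya sep' that by (auto intro!: prod_pos)
  have Na: "\<bar>poly (?N a) (x i)\<bar> = zfactor n a b (x i) * e b (x i)"
    and Na': "\<bar>poly (?N a') (x i)\<bar> = zfactor n a' b' (x i) * e b' (x i)"
    and Nb: "\<bar>poly (?N b) (y i)\<bar> = zfactor n b a (y i) * e a (y i)"
    and Nb': "\<bar>poly (?N b') (y i)\<bar> = zfactor n b' a' (y i) * e a' (y i)" if "i \<le> n" for i
    unfolding e_def by (rule abs_root_poly_eq_zfactor, use xb ya sep' that in blast)+
  have prod: "zfactor n a b (x i) * zfactor n b a (y j) = \<mu>" if "i \<le> n" "j \<le> n" for i j
    using \<mu>(2)[OF that] by (simp add: abs_zprod_factor)
  define \<alpha> where "\<alpha> = zfactor n a b (x 0)"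
  define \<beta> where "\<beta> = zfactor n b a (y 0)"
  have \<alpha>\<beta>: "\<alpha> * \<beta> = \<mu>" unfolding \<alpha>_def \<beta>_def by (rule prod) auto
  then have pos: "0 < \<alpha>" "0 < \<beta>"
    using \<mu>(1) zfactor_nonneg[of n a b "x 0"] zfactor_nonneg[of n b a "y 0"]
    by (auto simp: \<alpha>_def \<beta>_def less_le)
  have \<alpha>: "zfactor n a b (x i) = \<alpha>" if "i \<le> n" for i
    using prod[OF that, of 0] \<alpha>\<beta> pos unfolding \<beta>_def[symmetric] by auto
  have \<beta>: "zfactor n b a (y j) = \<beta>" if "j \<le> n" for j
    using prod[OF _ that, of 0] \<alpha>\<beta> pos unfolding \<alpha>_def[symmetric] by auto
  \<comment> \<open>The smallest factor for which domination holds at the \<open>x i\<close>; that it also holds at the \<open>y j\<close>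
     is the hypothesis on the products.\<close>
  define s where "s = Max ((\<lambda>i. zfactor n a' b' (x i)) ` {..n}) / \<alpha>"
  have s\<alpha>: "s * \<alpha> = Max ((\<lambda>i. zfactor n a' b' (x i)) ` {..n})" using pos by (simp add: s_def)
  have s1: "zfactor n a' b' (x i) \<le> s * \<alpha>" if "i \<le> n" for i
    unfolding s\<alpha> using that by (intro Max_ge) auto
  have s2: "s * zfactor n b' a' (y j) \<le> \<beta>" if "j \<le> n" for j
  proof -
    have "s * \<alpha> \<in> (\<lambda>i. zfactor n a' b' (x i)) ` {..n}"
      unfolding s\<alpha> by (rule Max_in) auto
    then obtain i where "i \<le> n" "s * \<alpha> = zfactor n a' b' (x i)" by auto
    then have "(s * \<alpha>) * zfactor n b' a' (y j) \<le> \<alpha> * \<beta>"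
      using le[of i j] that \<alpha>\<beta> by (simp add: abs_zprod_factor)
    then have "\<alpha> * (s * zfactor n b' a' (y j)) \<le> \<alpha> * \<beta>" by (simp only: mult_ac)
    then show ?thesis using pos by simp
  qed
  have s0: "0 \<le> s" using s1[of 0] zfactor_nonneg[of n a' b' "x 0"] pos
    by (metis le0 mult_less_cancel_right_pos mult_zero_left not_le order_trans)
  define P where "P = smult s (?N a * ?N (\<lambda>i. - b' i)) - ?N a' * ?N (\<lambda>i. - b i)"
  have E: "poly (?N (\<lambda>i. - c i)) t = e c t" for c t by (simp add: poly_root_poly e_def)
  have E': "poly (?N (\<lambda>i. - c i)) (- t) = (-1) ^ n * poly (?N c) t" for c t
    by (simp add: poly_root_poly_minus) (simp add: poly_root_poly)
  have N': "poly (?N c) (- t) = (-1) ^ n * e c t" for c t by (simp add: poly_root_poly_minus e_def)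
  have Px: "0 \<le> (-1) ^ i * poly P (x i)" if i: "i \<le> n" for i
  proof -
    have "\<bar>poly (?N a') (x i)\<bar> * e b (x i) \<le> s * \<bar>poly (?N a) (x i)\<bar> * e b' (x i)"
      unfolding Na[OF i] Na'[OF i] \<alpha>[OF i]
      using mult_right_mono[OF s1[OF i], of "e b' (x i) * e b (x i)"] e[OF i] by (simp add: mult_ac)
    moreover have "\<bar>poly (?N a) (x i)\<bar> = (-1) ^ i * poly (?N a) (x i)"
      using root_poly_sign[OF xa i] by (cases "even i") auto
    moreover have "(-1) ^ i * poly (?N a') (x i) * e b (x i) \<le> \<bar>poly (?N a') (x i)\<bar> * e b (x i)"
      using e[OF i] by (intro mult_right_mono) (cases "even i", auto)
    ultimately show ?thesis by (simp add: P_def E algebra_simps)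
  qed
  have Py: "(-1) ^ j * poly P (- y j) \<le> 0" if j: "j \<le> n" for j
  proof -
    have "s * \<bar>poly (?N b') (y j)\<bar> * e a (y j) \<le> \<bar>poly (?N b) (y j)\<bar> * e a' (y j)"
      unfolding Nb[OF j] Nb'[OF j] \<beta>[OF j]
      using mult_right_mono[OF s2[OF j], of "e a' (y j) * e a (y j)"] e[OF j] by (simp add: mult_ac)
    moreover have abs_b: "\<bar>poly (?N b) (y j)\<bar> = (-1) ^ j * poly (?N b) (y j)"
      using root_poly_sign[OF yb j] by (cases "even j") auto
    moreover have "s * ((-1) ^ j * poly (?N b') (y j)) * e a (y j) \<le> s * \<bar>poly (?N b') (y j)\<bar> * e a (y j)"
      using e[OF j] s0 by (intro mult_right_mono mult_left_mono) (cases "even j", auto)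
    moreover have "(-1) ^ j * poly P (- y j) = s * ((-1) ^ j * poly (?N b') (y j)) * e a (y j)
        - \<bar>poly (?N b) (y j)\<bar> * e a' (y j)"
    proof -
      have P_y: "poly P (- y j) = s * (e a (y j) * poly (?N b') (y j)) - e a' (y j) * poly (?N b) (y j)"
      proof -
        have "poly P (- y j) = ((-1) ^ n * (-1) ^ n) * (s * (e a (y j) * poly (?N b') (y j))
          - e a' (y j) * poly (?N b) (y j))"
        by (simp only: P_def E' N' poly_diff poly_smult poly_mult) (simp only: algebra_simps)
        then show ?thesis by (simp flip: power_mult_distrib)
      qed
      show ?thesis unfolding P_y abs_b by (simp add: algebra_simps)
    qed
    ultimately show ?thesis by linarith
  qed
  define t where "t k = (if k \<le> n then x k else - y (2 * n + 1 - k))" for k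
  have "P = 0"
  proof (rule alternating_poly_eq_0)
    have x: "decreasing_to n x" and y: "decreasing_to n y"
      using xa yb strictly_interlaced_decreasing by auto
    show "decreasing_to (Suc (2 * n)) t"
      unfolding decreasing_to_def
    proof (intro allI impI)
      fix i k assume ik: "i < k" "k \<le> Suc (2 * n)"
      consider "k \<le> n" | "i \<le> n" "n < k" | "n < i" using ik by linarith
      then show "t k < t i"
      proof cases
        case 2
        then have "2 * n + 1 - k \<le> n" by linarith
        then show ?thesis using sep[of i "2 * n + 1 - k"] 2 by (simp add: t_def)
      next
        case 3
        then have "y (2 * n + 1 - i) < y (2 * n + 1 - k)"
          using y ik unfolding decreasing_to_def by (intro y[unfolded decreasing_to_def, rule_format]) auto
        then show ?thesis using 3 ik by (simp add: t_def)
      qed (use x ik in \<open>auto simp: t_def decreasing_to_def\<close>)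
    qed
    have deg: "degree (?N c * ?N d) \<le> 2 * n" for c d
      using degree_mult_le[of "?N c" "?N d"] by (simp add: degree_root_poly)
    show "degree P \<le> 2 * n"
      unfolding P_def by (rule degree_diff_le[OF order_trans[OF degree_smult_le deg] deg])
    fix k assume k: "k \<le> Suc (2 * n)"
    show "0 \<le> (-1) ^ k * poly P (t k)"
    proof (cases "k \<le> n")
      case False
      define j where "j = 2 * n + 1 - k"
      have "(-1 :: real) ^ k = - ((-1) ^ j)"
      proof -
        have "even k \<longleftrightarrow> odd j" using k by (auto simp: j_def)
        then show ?thesis by (cases "even k") auto
      qed
      then show ?thesis using Py[of j] False k by (simp add: t_def j_def)
    qed (use Px in \<open>simp add: t_def\<close>)
  qed
  then have eq: "smult s (?N a * ?N (\<lambda>i. - b' i)) = ?N a' * ?N (\<lambda>i. - b i)" by (simp add: P_def)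
  have "a ` {..<n} \<subseteq> a' ` {..<n}"
  proof
    fix z assume "z \<in> a ` {..<n}"
    then obtain k where k: "k < n" "z = a k" by auto
    have "poly (?N a) z = 0" using k by (auto simp: poly_root_poly)
    then have "poly (?N a') z * e b z = 0"
      using arg_cong[OF eq, of "\<lambda>P. poly P z"] by (simp add: E)
    moreover have "0 < z + b l" if "l < n" for l
      using xb[of "Suc k" l] k xa that by (force simp: strictly_interlaced_def)
    then have "0 < e b z" unfolding e_def by (intro prod_pos) auto
    ultimately show "z \<in> a' ` {..<n}" by (auto simp: poly_root_poly)
  qed
  then have "n \<le> card (a' ` {..<n})"
    using card_mono[of "a' ` {..<n}" "a ` {..<n}"] strictly_interlaced_inj[OF xa] by (simp add: card_image)
  then show ?thesis using card_image_le[of "{..<n}" a'] by (intro eq_card_imp_inj_on) auto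
qed

section \<open>The lower bound for low-rank approximations\<close>

lemma nontrivial_relation:
  fixes g :: "nat \<Rightarrow> 'a::euclidean_space"
  assumes "n = DIM('a)"
  shows "\<exists>w. (\<Sum>j\<le>n. w j *\<^sub>R g j) = 0 \<and> (\<exists>j\<le>n. w j \<noteq> 0)"
proof (cases "inj_on g {..n}")
  case True
  have "dependent (g ` {..n})"
    using True assms by (intro dependent_biggerset) (auto simp: card_image)
  then obtain u v where v: "v \<in> g ` {..n}" "u v \<noteq> 0" and sum: "(\<Sum>v\<in>g ` {..n}. u v *\<^sub>R v) = 0"
    by (auto simp: dependent_finite)
  have "(\<Sum>j\<le>n. u (g j) *\<^sub>R g j) = 0"
    using sum by (simp add: sum.reindex[OF True])
  then show ?thesis using v by (intro exI[of _ "\<lambda>j. u (g j)"]) auto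
next
  case False
  then obtain i k where ik: "i \<le> n" "k \<le> n" "i \<noteq> k" "g i = g k" by (auto simp: inj_on_def)
  let ?w = "\<lambda>j. (if j = i then 1 else 0) - (if j = k then 1 else 0) :: real"
  have "(\<Sum>j\<le>n. ?w j *\<^sub>R g j) = 0"
    using ik by (simp add: scaleR_diff_left sum_subtractf if_distrib[of "\<lambda>c. c *\<^sub>R _"] cong: if_cong)
  then show ?thesis using ik by (intro exI[of _ ?w]) auto
qed

text \<open>Suppose all errors are smaller than \<open>\<mu>\<close>.  Let \<open>w\<close> be a linear relation between the \<open>n + 1\<close> vectors
\<open>g j\<close> in dimension \<open>n\<close>, and \<open>W\<close> the numerator of \<open>\<Sum>j. w j / (x + y j)\<close>, of degree at most \<open>n\<close>.
The relation expresses \<open>W (x i)\<close> through the errors, so \<open>W (x i)\<close> is less than \<open>\<mu>\<close> times the same sum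
with moduli.  The polynomial \<open>N\<^sub>a\<close> with zeros \<open>a\<close> arises in this way from the skeleton, and for it this
bound is an equality, by equioscillation.  If \<open>c N\<^sub>a\<close> dominates \<open>W\<close> at all \<open>- y j\<close> and agrees with it
at \<open>- y m\<close>, then \<open>c N\<^sub>a - W\<close> alternates at \<open>x 0 > \<dots> > x n\<close> and vanishes at \<open>- y m\<close>: too often.\<close>

theorem equioscillation_lower_bound:
  fixes f g :: "nat \<Rightarrow> real ^ 'r::finite"
  assumes n: "n = CARD('r)"
    and equi: "equioscillation n x a y b \<mu>"
  shows "\<exists>i\<le>n. \<exists>j\<le>n. \<mu> \<le> \<bar>1 - (x i + y j) * (f i \<bullet> g j)\<bar>"
proof (rule ccontr)
  note xa = equioscillationD(1)[OF equi] and yb = equioscillationD(2)[OF equi]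
    and sep = equioscillationD(3)[OF equi] and \<mu> = equioscillationD(4,5)[OF equi]
  let ?N = "\<lambda>a t. poly (root_poly {..<n} a) t"
  define err where "err i j = 1 - (x i + y j) * (f i \<bullet> g j)" for i j
  assume "\<not> (\<exists>i\<le>n. \<exists>j\<le>n. \<mu> \<le> \<bar>1 - (x i + y j) * (f i \<bullet> g j)\<bar>)"
  then have small: "\<bar>err i j\<bar> < \<mu>" if "i \<le> n" "j \<le> n" for i j
    using that unfolding err_def by (meson not_le)
  have x: "decreasing_to n x" and y: "decreasing_to n y"
    using xa yb strictly_interlaced_decreasing by auto
  obtain w j1 where w: "(\<Sum>j\<le>n. w j *\<^sub>R g j) = 0" and j1: "j1 \<le> n" "w j1 \<noteq> 0"
    using nontrivial_relation[of n g] n by auto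
  define z where "z j = - y j" for j
  have z_inj: "inj_on z {..n}" using decreasing_to_inj[OF y] by (auto simp: z_def inj_on_def)
  define d where "d j = (\<Prod>k\<in>{..n} - {j}. z j - z k)" for j
  have d: "d j \<noteq> 0" if "j \<le> n" for j
    unfolding d_def using z_inj that by (auto simp: inj_on_def)
  define L where "L i j = lagrange_basis {..n} z j (x i)" for i j
  define \<omega> where "\<omega> i = (\<Prod>k\<le>n. x i + y k)" for i
  have L: "L i j * d j = \<omega> i / (x i + y j)" if "i \<le> n" "j \<le> n" for i j
  proof -
    have "\<omega> i = (x i + y j) * (\<Prod>k\<in>{..n} - {j}. x i + y k)"
      unfolding \<omega>_def using that by (intro prod.remove) auto
    moreover have "L i j * d j = (\<Prod>k\<in>{..n} - {j}. x i + y k)"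
      using d[OF that(2)] unfolding L_def lagrange_basis_def d_def prod_dividef by (simp add: z_def)
    ultimately show ?thesis using sep[OF that] by simp
  qed
  have L_y: "L i j = lagrange_basis {..n} y j (- x i)" for i j
    unfolding L_def lagrange_basis_def
  proof (rule prod.cong)
    fix k
    have "(x i - z k) / (z j - z k) = (- (x i - z k)) / (- (z j - z k))"
      by (rule minus_divide_divide[symmetric])
    then show "(x i - z k) / (z j - z k) = (- x i - y k) / (y j - y k)" by (simp add: z_def algebra_simps)
  qed simp
  have L_pos: "0 < \<bar>L i j\<bar>" if "i \<le> n" "j \<le> n" for i j
    unfolding L_y using sep[OF that(1)] that by (intro abs_lagrange_basis_pos y) (force simp: neg_less_iff_less)+
  \<comment> \<open>\<open>W x = (\<Sum>j. w j / (x + y j)) * (\<Prod>k. x + y k)\<close>, given by its values at the \<open>z j\<close>.\<close>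
  define W where "W = lagrange_poly {..n} z (\<lambda>j. w j * d j)"
  have W_z: "poly W (z j) = w j * d j" if "j \<le> n" for j
    unfolding W_def using that by (intro poly_lagrange_poly_node z_inj) auto
  have W_x: "poly W (x i) = (\<Sum>j\<le>n. w j * d j * L i j)" for i
    unfolding W_def L_def by (rule poly_lagrange_poly)
  have W_err: "poly W (x i) = (\<Sum>j\<le>n. w j * d j * L i j * err i j)" if i: "i \<le> n" for i
  proof -
    have "0 = \<omega> i * (f i \<bullet> (\<Sum>j\<le>n. w j *\<^sub>R g j))" unfolding w by simp
    also have "\<dots> = (\<Sum>j\<le>n. \<omega> i * (w j * (f i \<bullet> g j)))" by (simp add: inner_sum_right sum_distrib_left)
    also have "\<dots> = (\<Sum>j\<le>n. w j * d j * L i j - w j * d j * L i j * err i j)"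
    proof (rule sum.cong)
      fix j assume "j \<in> {..n}"
      then have "L i j * d j = \<omega> i / (x i + y j)" "x i + y j \<noteq> 0"
        using L[OF i, of j] sep[OF i, of j] by auto
      then have \<omega>: "\<omega> i = L i j * d j * (x i + y j)" by simp
      show "\<omega> i * (w j * (f i \<bullet> g j)) = w j * d j * L i j - w j * d j * L i j * err i j"
        unfolding err_def \<omega> by (simp add: algebra_simps)
    qed simp
    finally show ?thesis unfolding W_x by (simp add: sum_subtractf)
  qed
  have posNa: "0 < \<bar>?N a (z j)\<bar>" if "j \<le> n" for j
  proof -
    have "\<bar>?N a (z j)\<bar> = (\<Sum>i\<le>n. \<bar>?N a (x i)\<bar> * \<bar>lagrange_basis {..n} x i (z j)\<bar>)"
      using root_poly_sign[OF xa] sep that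
      by (intro alternating_abs_below x) (force simp: z_def degree_root_poly less_imp_le neg_less_iff_less)+
    also have "\<dots> > 0"
    proof (intro sum_pos mult_pos_pos abs_lagrange_basis_pos x)
      show "0 < \<bar>?N a (x i)\<bar>" if "i \<in> {..n}" for i using root_poly_sign[OF xa, of i] that by auto
      show "z j < x i" if "i \<le> n" for i using sep[OF that \<open>j \<le> n\<close>] by (simp add: z_def)
    qed auto
    finally show ?thesis .
  qed
  \<comment> \<open>Scale \<open>N\<^sub>a\<close> so that it dominates \<open>W\<close> at all \<open>z j\<close> and touches it at \<open>z m\<close>.\<close>
  obtain m where m: "m \<le> n" "\<And>j. j \<le> n \<Longrightarrow> \<bar>poly W (z j)\<bar> / \<bar>?N a (z j)\<bar> \<le> \<bar>poly W (z m)\<bar> / \<bar>?N a (z m)\<bar>"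
    using Max_in[of "(\<lambda>j. \<bar>poly W (z j)\<bar> / \<bar>?N a (z j)\<bar>) ` {..n}"]
      Max_ge[of "(\<lambda>j. \<bar>poly W (z j)\<bar> / \<bar>?N a (z j)\<bar>) ` {..n}"] by fastforce
  define c where "c = poly W (z m) / ?N a (z m)"
  have touch: "poly W (z m) = c * ?N a (z m)" using posNa[OF m(1)] by (simp add: c_def)
  have dom: "\<bar>poly W (z j)\<bar> \<le> \<bar>c\<bar> * \<bar>?N a (z j)\<bar>" if "j \<le> n" for j
    using m(2)[OF that] posNa[OF that] by (simp add: c_def divide_le_eq)
  have c: "c \<noteq> 0"
    using dom[OF j1(1)] W_z[OF j1(1)] j1 d[OF j1(1)] by auto
  have Na_x: "\<mu> * (\<Sum>j\<le>n. \<bar>?N a (z j)\<bar> * \<bar>L i j\<bar>) = \<bar>?N a (x i)\<bar>" if i: "i \<le> n" for i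
  proof -
    have Nb: "\<bar>?N b (- x i)\<bar> = (\<Sum>j\<le>n. \<bar>?N b (y j)\<bar> * \<bar>L i j\<bar>)"
      unfolding L_y using root_poly_sign[OF yb] sep[OF i]
      by (intro alternating_abs_below y) (force simp: degree_root_poly less_imp_le neg_less_iff_less)+
    have Nb_pos: "0 < \<bar>?N b (- x i)\<bar>"
      unfolding Nb
    proof (intro sum_pos mult_pos_pos)
      show "0 < \<bar>?N b (y j)\<bar>" if "j \<in> {..n}" for j using root_poly_sign[OF yb, of j] that by auto
    qed (use L_pos[OF i] in auto)
    have "\<mu> * \<bar>?N a (z j)\<bar> * \<bar>?N b (- x i)\<bar> = \<bar>?N a (x i)\<bar> * \<bar>?N b (y j)\<bar>" if "j \<le> n" for j
      using \<mu>(2)[OF i that] posNa[OF that] Nb_pos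
      unfolding abs_zprod z_def by (auto simp: field_simps)
    then have "\<bar>?N b (- x i)\<bar> * (\<mu> * (\<Sum>j\<le>n. \<bar>?N a (z j)\<bar> * \<bar>L i j\<bar>))
        = (\<Sum>j\<le>n. \<bar>?N a (x i)\<bar> * \<bar>?N b (y j)\<bar> * \<bar>L i j\<bar>)"
      unfolding sum_distrib_left by (intro sum.cong) (auto simp: mult_ac)
    also have "\<dots> = \<bar>?N b (- x i)\<bar> * \<bar>?N a (x i)\<bar>"
      unfolding Nb sum_distrib_right by (simp add: mult_ac)
    finally show ?thesis using Nb_pos by simp
  qed
  have less: "\<bar>poly W (x i)\<bar> < \<bar>c\<bar> * \<bar>?N a (x i)\<bar>" if i: "i \<le> n" for i
  proof -
    have "\<bar>poly W (x i)\<bar> \<le> (\<Sum>j\<le>n. \<bar>w j * d j * L i j\<bar> * \<bar>err i j\<bar>)"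
      unfolding W_err[OF i] by (rule order_trans[OF sum_abs]) (simp add: abs_mult)
    also have "\<dots> < (\<Sum>j\<le>n. \<bar>w j * d j * L i j\<bar> * \<mu>)"
    proof (rule sum_strict_mono_ex1)
      show "\<forall>j\<in>{..n}. \<bar>w j * d j * L i j\<bar> * \<bar>err i j\<bar> \<le> \<bar>w j * d j * L i j\<bar> * \<mu>"
        using less_imp_le[OF small[OF i]] by (intro ballI mult_left_mono) auto
      show "\<exists>j\<in>{..n}. \<bar>w j * d j * L i j\<bar> * \<bar>err i j\<bar> < \<bar>w j * d j * L i j\<bar> * \<mu>"
        using small[OF i j1(1)] j1 d[OF j1(1)] L_pos[OF i j1(1)]
        by (intro bexI[of _ j1] mult_strict_left_mono) auto
    qed simp
    also have "\<dots> \<le> (\<Sum>j\<le>n. \<bar>c\<bar> * \<bar>?N a (z j)\<bar> * \<bar>L i j\<bar> * \<mu>)"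
    proof (intro sum_mono mult_right_mono)
      fix j assume "j \<in> {..n}"
      then show "\<bar>w j * d j * L i j\<bar> \<le> \<bar>c\<bar> * \<bar>?N a (z j)\<bar> * \<bar>L i j\<bar>"
        using dom[of j] by (simp add: W_z abs_mult mult_right_mono)
    qed (use \<mu> in simp)
    also have "\<dots> = \<bar>c\<bar> * (\<mu> * (\<Sum>j\<le>n. \<bar>?N a (z j)\<bar> * \<bar>L i j\<bar>))"
      by (simp add: sum_distrib_left mult_ac)
    finally show ?thesis unfolding Na_x[OF i] .
  qed
  define D where "D = smult (sgn c) (smult c (root_poly {..<n} a) - W)"
  have D_pos: "0 < (-1) ^ i * poly D (x i)" if i: "i \<le> n" for i
  proof -
    have "(-1) ^ i * poly D (x i) = \<bar>c\<bar> * ((-1) ^ i * ?N a (x i)) - sgn c * (-1) ^ i * poly W (x i)"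
      using c by (simp add: D_def abs_sgn algebra_simps)
    also have "(-1) ^ i * ?N a (x i) = \<bar>?N a (x i)\<bar>"
      using root_poly_sign[OF xa i] by (cases "even i") auto
    moreover have "sgn c * (-1) ^ i * poly W (x i) \<le> \<bar>poly W (x i)\<bar>"
      by (cases "even i") (auto simp: sgn_if)
    ultimately show ?thesis using less[OF i] by simp
  qed
  define t where "t k = (if k \<le> n then x k else z m)" for k
  have "D = 0"
  proof (rule alternating_poly_eq_0)
    show "decreasing_to (Suc n) t"
      unfolding decreasing_to_def
    proof (intro allI impI)
      fix i k assume "i < k" "k \<le> Suc n"
      then show "t k < t i"
        using x sep[of i m] m(1) by (cases "k \<le> n") (auto simp: t_def z_def decreasing_to_def)
    qed
    have "degree W \<le> n" unfolding W_def by (rule degree_lagrange_poly) auto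
    then have "degree (smult c (root_poly {..<n} a) - W) \<le> n"
      using degree_smult_le[of c "root_poly {..<n} a"] by (intro degree_diff_le) (auto simp: degree_root_poly)
    then show "degree D \<le> n" unfolding D_def by (rule order_trans[OF degree_smult_le])
    show "0 \<le> (-1) ^ i * poly D (t i)" if "i \<le> Suc n" for i
    proof (cases "i \<le> n")
      case True
      then show ?thesis using D_pos by (simp add: t_def less_imp_le)
    next
      case False
      then show ?thesis by (simp add: t_def D_def touch)
    qed
  qed
  then show False using D_pos[of 0] by simp
qed

section \<open>Cauchy matrices and the skeleton decomposition\<close>

text \<open>A kernel vector \<open>v\<close> gives a rational function \<open>\<Sum>j. v j / (x - yt j)\<close> that vanishes at all \<open>xt i\<close>; its
numerator has degree less than \<open>r\<close>, so distinct \<open>xt i\<close> force it to be zero, and for distinct \<open>yt j\<close>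
all residues \<open>v j\<close> vanish with it.\<close>

lemma invertible_cauchy_matrix_iff:
  fixes xt yt :: "real ^ 'r::finite"
  assumes apart: "\<And>i j. xt $ i \<noteq> yt $ j"
  shows "invertible (cauchy_matrix xt yt) \<longleftrightarrow> inj (($) xt) \<and> inj (($) yt)"
proof
  assume inv: "invertible (cauchy_matrix xt yt)"
  have "inj (($) xt)"
  proof (rule injI, rule ccontr)
    fix i k assume "xt $ i = xt $ k" "i \<noteq> k"
    then have "det (cauchy_matrix xt yt) = 0"
      by (intro det_identical_rows[of i k]) (auto simp: row_def cauchy_matrix_def vec_eq_iff)
    then show False using inv by (simp add: invertible_det_nz)
  qed
  moreover have "inj (($) yt)"
  proof (rule injI, rule ccontr)
    fix i k assume "yt $ i = yt $ k" "i \<noteq> k"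
    then have "det (cauchy_matrix xt yt) = 0"
      by (intro det_identical_columns[of i k]) (auto simp: column_def cauchy_matrix_def vec_eq_iff)
    then show False using inv by (simp add: invertible_det_nz)
  qed
  ultimately show "inj (($) xt) \<and> inj (($) yt)" by simp
next
  assume inj: "inj (($) xt) \<and> inj (($) yt)"
  have "v = 0" if ker: "cauchy_matrix xt yt *v v = 0" for v
  proof -
    define d where "d j = (\<Prod>k\<in>UNIV - {j}. yt $ j - yt $ k)" for j
    have d: "d j \<noteq> 0" for j using inj by (auto simp: d_def inj_def)
    define V where "V = lagrange_poly UNIV (($) yt) (\<lambda>j. v $ j * d j)"
    have "poly V (xt $ i) = 0" for i
    proof -
      have L: "d j * lagrange_basis UNIV (($) yt) j (xt $ i) = (\<Prod>k\<in>UNIV. xt $ i - yt $ k) / (xt $ i - yt $ j)" for j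
      proof -
        have "(\<Prod>k\<in>UNIV. xt $ i - yt $ k) = (xt $ i - yt $ j) * (\<Prod>k\<in>UNIV - {j}. xt $ i - yt $ k)"
          by (rule prod.remove) auto
        then show ?thesis
          using d[of j] apart[of i j] by (simp add: lagrange_basis_def prod_dividef d_def)
      qed
      have "poly V (xt $ i) = (\<Sum>j\<in>UNIV. v $ j * (d j * lagrange_basis UNIV (($) yt) j (xt $ i)))"
        unfolding V_def poly_lagrange_poly by (simp add: mult.assoc)
      also have "\<dots> = (\<Prod>k\<in>UNIV. xt $ i - yt $ k) * (cauchy_matrix xt yt *v v) $ i"
        unfolding L by (simp add: matrix_vector_mult_def cauchy_matrix_def sum_distrib_left mult_ac)
      finally show ?thesis using ker by simp
    qed
    moreover have "degree V < CARD('r)"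
    proof -
      obtain n where n: "CARD('r) = Suc n" by (cases "CARD('r)") auto
      then show ?thesis using degree_lagrange_poly[of "UNIV :: 'r set" n] by (simp add: V_def less_Suc_eq_le)
    qed
    ultimately have "V = 0"
      using inj by (intro poly_eqI_degree[where A = "range (($) xt)"]) (auto simp: card_image)
    moreover have "poly V (yt $ j) = v $ j * d j" for j
      unfolding V_def using inj by (intro poly_lagrange_poly_node) auto
    ultimately show "v = 0" using d by (simp add: vec_eq_iff)
  qed
  then show "invertible (cauchy_matrix xt yt)"
    unfolding invertible_left_inverse matrix_left_invertible_ker by blast
qed

definition skeleton_left :: "real ^ 'r \<Rightarrow> real ^ 'r \<Rightarrow> real \<Rightarrow> real ^ 'r" where
  "skeleton_left xt yt x = (cauchy_matrix (vec x :: real ^ 1) yt ** matrix_inv (cauchy_matrix xt yt)) $ 1"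

definition skeleton_right :: "real ^ 'r \<Rightarrow> real \<Rightarrow> real ^ 'r" where
  "skeleton_right xt y = (\<chi> i. 1 / (xt $ i - y))"

lemma skeleton_eq_inner: "skeleton xt yt x y = skeleton_left xt yt x \<bullet> skeleton_right xt y"
  unfolding skeleton_def skeleton_left_def skeleton_right_def
  by (subst matrix_matrix_mult_def) (simp add: inner_vec_def cauchy_matrix_def)

lemma skeleton_left_interpolates:
  fixes xt yt :: "real ^ 'r::finite"
  assumes "invertible (cauchy_matrix xt yt)"
  shows "(\<Sum>i\<in>UNIV. skeleton_left xt yt x $ i / (xt $ i - yt $ j)) = 1 / (x - yt $ j)"
proof -
  let ?C = "cauchy_matrix xt yt" and ?R = "cauchy_matrix (vec x :: real ^ 1) yt"
  have "matrix_inv ?C ** ?C = mat 1"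
    using assms unfolding invertible_def matrix_inv_def by (metis (mono_tags, lifting) someI_ex)
  then have "(?R ** matrix_inv ?C) ** ?C = ?R"
    by (simp add: matrix_mul_assoc[symmetric])
  then have "((?R ** matrix_inv ?C) ** ?C) $ 1 $ j = ?R $ 1 $ j" by simp
  then show ?thesis
    unfolding skeleton_left_def by (subst (asm) matrix_matrix_mult_def) (simp add: cauchy_matrix_def)
qed

definition zratio :: "real ^ 'r::finite \<Rightarrow> real ^ 'r \<Rightarrow> real \<Rightarrow> real \<Rightarrow> real" where
  "zratio xt yt x y = (\<Prod>i\<in>UNIV. ((x - xt $ i) * (y - yt $ i)) / ((x - yt $ i) * (y - xt $ i)))"

text \<open>As a function of \<open>y\<close>, the error multiplied by \<open>\<Prod>i. y - xt i\<close> is a polynomial \<open>W\<close> of degree at most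
\<open>r\<close>.  It vanishes at the \<open>yt j\<close>, because the skeleton interpolates the kernel there, and its value at
\<open>y = x\<close> is known; this determines it.\<close>

theorem skeleton_error:
  fixes xt yt :: "real ^ 'r::finite"
  assumes inv: "invertible (cauchy_matrix xt yt)"
    and apart: "\<And>i j. xt $ i \<noteq> yt $ j" and x: "\<And>j. x \<noteq> yt $ j" and y: "\<And>i. y \<noteq> xt $ i"
  shows "1 - (x - y) * skeleton xt yt x y = zratio xt yt x y"
proof -
  let ?K = "root_poly UNIV (($) xt)" and ?Q = "root_poly UNIV (($) yt)"
  define c where "c i = skeleton_left xt yt x $ i" for i
  define T where "T = (\<Sum>i\<in>UNIV. smult (c i) (root_poly (UNIV - {i}) (($) xt)))"
  define W where "W = ?K + [:x, -1:] * T"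
  define D where "D = smult (poly ?Q x) W - smult (poly ?K x) ?Q"
  have K: "poly ?K s = (s - xt $ i) * (\<Prod>k\<in>UNIV - {i}. s - xt $ k)" for s i
    unfolding poly_root_poly by (rule prod.remove) auto
  have W: "poly W s = poly ?K s * (1 - (x - s) * (\<Sum>i\<in>UNIV. c i / (xt $ i - s)))"
    if s: "\<And>i. s \<noteq> xt $ i" for s
  proof -
    have "poly T s = (\<Sum>i\<in>UNIV. - (poly ?K s * (c i / (xt $ i - s))))"
      unfolding T_def poly_sum poly_smult
    proof (rule sum.cong)
      fix i
      have "c i / (xt $ i - s) = - (c i / (s - xt $ i))" "s - xt $ i \<noteq> 0"
        using s[of i] minus_divide_right[of "c i" "s - xt $ i"] by simp_all
      then show "c i * poly (root_poly (UNIV - {i}) (($) xt)) s = - (poly ?K s * (c i / (xt $ i - s)))"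
        unfolding K[of s i] by (simp add: poly_root_poly)
    qed simp
    then have "poly T s = - (poly ?K s * (\<Sum>i\<in>UNIV. c i / (xt $ i - s)))"
      by (simp add: sum_negf sum_distrib_left)
    then show ?thesis by (simp add: W_def algebra_simps)
  qed
  have "D = 0"
  proof (rule poly_eqI_degree[where A = "insert x (range (($) yt))"])
    have "poly D (yt $ j) = 0" for j
    proof -
      have "(x - yt $ j) * (\<Sum>i\<in>UNIV. c i / (xt $ i - yt $ j)) = 1"
        using skeleton_left_interpolates[OF inv, of x j] x[of j] by (simp add: c_def)
      then have "poly W (yt $ j) = 0" using W[OF apart[THEN not_sym], of j] by simp
      moreover have "poly ?Q (yt $ j) = 0" by (auto simp: poly_root_poly)
      ultimately show ?thesis by (simp add: D_def)
    qed
    moreover have "poly D x = 0" by (simp add: D_def W_def)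
    ultimately show "poly D s = poly 0 s" if "s \<in> insert x (range (($) yt))" for s using that by auto
    have "inj (($) yt)" using inv invertible_cauchy_matrix_iff[OF apart] by simp
    then have card: "card (insert x (range (($) yt))) = Suc (CARD('r))"
      using x by (subst card_insert_disjoint) (auto simp: card_image)
    have "degree ([:x, -1:] * T) \<le> CARD('r)"
    proof -
      have "degree T \<le> CARD('r) - 1"
        unfolding T_def
        by (rule degree_sum_le) (auto intro!: order_trans[OF degree_smult_le] simp: degree_root_poly)
      moreover have "degree ([:x, -1:] * T) \<le> degree [:x, -1:] + degree T" by (rule degree_mult_le)
      moreover have "degree [:x, -1:] = 1" "0 < CARD('r)" by simp_all
      ultimately show ?thesis by linarith
    qed
    then have "degree W \<le> CARD('r)"
      unfolding W_def by (intro degree_add_le) (simp_all add: degree_root_poly)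
    then have "degree D \<le> CARD('r)"
      unfolding D_def by (intro degree_diff_le order_trans[OF degree_smult_le]) (simp_all add: degree_root_poly)
    then show "degree D < card (insert x (range (($) yt)))" unfolding card by simp
    show "degree (0 :: real poly) < card (insert x (range (($) yt)))" unfolding card by simp
  qed
  then have "poly D y = 0" by simp
  then have "poly ?Q x * poly W y = poly ?K x * poly ?Q y"
    by (simp add: D_def)
  moreover have "poly W y = poly ?K y * (1 - (x - y) * skeleton xt yt x y)"
    using W[OF y] by (simp add: skeleton_eq_inner inner_vec_def skeleton_right_def c_def)
  moreover have "poly ?Q x \<noteq> 0" "poly ?K y \<noteq> 0" using x y by (auto simp: poly_root_poly)
  ultimately have "1 - (x - y) * skeleton xt yt x y = (poly ?K x * poly ?Q y) / (poly ?Q x * poly ?K y)"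
    by (simp add: field_simps)
  also have "\<dots> = zratio xt yt x y"
    unfolding zratio_def poly_root_poly by (simp add: prod_dividef prod.distrib)
  finally show ?thesis .
qed

section \<open>Optimal nodes\<close>

lemma decreasing_points_exist:
  fixes X :: "real set"
  assumes "infinite X \<or> n < card X"
  shows "\<exists>x. decreasing_to n x \<and> (\<forall>i\<le>n. x i \<in> X)"
proof -
  obtain T where T: "T \<subseteq> X" "card T = Suc n" "finite T"
    using assms infinite_arbitrarily_large[of X "Suc n"] obtain_subset_with_card_n[of "Suc n" X]
    by (metis Suc_leI)
  let ?l = "sorted_list_of_set T"
  have len: "length ?l = Suc n" using T by simp
  have "decreasing_to n (\<lambda>i. ?l ! (n - i))"
    unfolding decreasing_to_def using len
    by (auto intro!: sorted_wrt_nth_less[OF strict_sorted_list_of_set])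
  moreover have "?l ! (n - i) \<in> X" for i
    using T len nth_mem[of "n - i" ?l] by auto
  ultimately show ?thesis by (intro exI[of _ "\<lambda>i. ?l ! (n - i)"]) simp
qed

lemma distinct_nodes_covering:
  fixes l u :: real
  assumes "l < u" and "finite X" and "X \<subseteq> {l..u}" and "card X \<le> CARD('r)"
  shows "\<exists>xt :: real ^ 'r::finite. inj (($) xt) \<and> (\<forall>i. xt $ i \<in> {l..u}) \<and> X \<subseteq> range (($) xt)"
proof -
  have "infinite ({l..u} - X)" using assms by (simp add: Diff_infinite_finite)
  then obtain B where B: "finite B" "card B = CARD('r) - card X" "B \<subseteq> {l..u} - X"
    using infinite_arbitrarily_large by blast
  have "card (X \<union> B) = CARD('r)"
    using B assms by (subst card_Un_disjoint) auto
  then obtain h :: "'r \<Rightarrow> real" where h: "bij_betw h UNIV (X \<union> B)"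
    using finite_same_card_bij[of "UNIV :: 'r set" "X \<union> B"] B(1) assms(2) by auto
  have range: "range (($) (\<chi> i. h i)) = X \<union> B" using h by (auto simp: bij_betw_def)
  show ?thesis
  proof (intro exI[of _ "\<chi> i. h i"] conjI)
    show "inj (($) (\<chi> i. h i))" using h by (auto simp: bij_betw_def inj_def)
    have "h i \<in> X \<union> B" for i using h by (auto simp: bij_betw_def)
    then show "\<forall>i. (\<chi> i. h i) $ i \<in> {l..u}" using B(3) assms(3) by fastforce
  qed (use range in blast)
qed

lemma compact_hull:
  fixes X :: "real set"
  assumes "compact X" and "x \<in> X"
  shows "Inf X \<le> x" and "x \<le> Sup X"
  using assms compact_imp_bounded[OF assms(1)]
  by (auto intro: cInf_lower cSup_upper bounded_imp_bdd_below bounded_imp_bdd_above)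

lemma hull_box_apart:
  assumes "compact X" and "compact Y" and "Inf X > Sup Y"
    and "xt \<in> hull_box X" and "yt \<in> hull_box Y"
  shows "yt $ j < xt $ i" and "x \<in> X \<Longrightarrow> yt $ j < x" and "y \<in> Y \<Longrightarrow> y < xt $ i"
  using assms compact_hull[OF assms(1), of x] compact_hull[OF assms(2), of y]
  by (auto simp: hull_box_def dest!: spec[of _ i] spec[of _ j])

lemma zolotarev_max_attained:
  fixes xt yt :: "real ^ 'r::finite"
  assumes "compact X" and "compact Y" and "X \<noteq> {}" and "Y \<noteq> {}" and "Inf X > Sup Y"
    and "xt \<in> hull_box X" and "yt \<in> hull_box Y"
  shows "\<exists>x\<in>X. \<exists>y\<in>Y. \<bar>zratio xt yt x y\<bar> = zolotarev_max X Y xt yt"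
    and "x \<in> X \<Longrightarrow> y \<in> Y \<Longrightarrow> \<bar>zratio xt yt x y\<bar> \<le> zolotarev_max X Y xt yt"
proof -
  note apart = hull_box_apart[OF assms(1,2,5-7)]
  let ?F = "\<lambda>(x, y). \<bar>zratio xt yt x y\<bar>"
  have zmax: "zolotarev_max X Y xt yt = Sup (?F ` (X \<times> Y))"
    by (simp add: zolotarev_max_def zratio_def)
  have "(x - yt $ i) * (y - xt $ i) \<noteq> 0" if "x \<in> X" "y \<in> Y" for x y i
    using apart(2)[OF that(1), of i] apart(3)[OF that(2), of i] by simp
  then have "continuous_on (X \<times> Y) ?F"
    unfolding zratio_def case_prod_beta by (intro continuous_intros) auto
  then obtain p where p: "p \<in> X \<times> Y" "\<And>q. q \<in> X \<times> Y \<Longrightarrow> ?F q \<le> ?F p"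
    using continuous_attains_sup[of "X \<times> Y" ?F] compact_Times[OF assms(1,2)] assms(3,4) by auto
  then have "Sup (?F ` (X \<times> Y)) = ?F p" by (intro cSup_eq_maximum) auto
  then show "\<exists>x\<in>X. \<exists>y\<in>Y. \<bar>zratio xt yt x y\<bar> = zolotarev_max X Y xt yt"
    and "x \<in> X \<Longrightarrow> y \<in> Y \<Longrightarrow> \<bar>zratio xt yt x y\<bar> \<le> zolotarev_max X Y xt yt"
    unfolding zmax using p by force+
qed

lemma zratio_eq_zprod:
  fixes xt yt :: "real ^ 'r::finite"
  assumes "bij_betw h {..<n} (UNIV :: 'r set)"
  shows "zratio xt yt x y = zprod n (\<lambda>k. xt $ h k) (\<lambda>k. - yt $ h k) x (- y)"
proof -
  have "zratio xt yt x y = (\<Prod>k<n. ((x - xt $ h k) * (y - yt $ h k)) / ((x - yt $ h k) * (y - xt $ h k)))"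
    unfolding zratio_def by (rule prod.reindex_bij_betw[OF assms, symmetric])
  also have "\<dots> = zprod n (\<lambda>k. xt $ h k) (\<lambda>k. - yt $ h k) x (- y)"
    unfolding zprod_def
  proof (rule prod.cong)
    fix k
    have "((x - xt $ h k) * (y - yt $ h k)) / ((x - yt $ h k) * (y - xt $ h k))
        = (- ((x - xt $ h k) * (y - yt $ h k))) / (- ((x - yt $ h k) * (y - xt $ h k)))"
      by (rule minus_divide_divide[symmetric])
    then show "((x - xt $ h k) * (y - yt $ h k)) / ((x - yt $ h k) * (y - xt $ h k))
        = ((x - xt $ h k) * (- y - - yt $ h k)) / ((x + - yt $ h k) * (- y + xt $ h k))"
      by (simp add: algebra_simps)
  qed simp
  finally show ?thesis .
qed

text \<open>What the degenerate and the equioscillating case have in common: distinct nodes that reach a value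
\<open>\<mu>\<close> which no low-rank approximation can beat.  In the degenerate case \<open>\<mu> = 0\<close>, and there repeated
nodes can be optimal as well, hence the restriction to \<open>0 < \<mu>\<close> in the last clause.\<close>

definition optimal_nodes ::
  "real set \<Rightarrow> real set \<Rightarrow> real \<Rightarrow> real ^ 'r \<Rightarrow> real ^ 'r \<Rightarrow> bool" where
  "optimal_nodes X Y \<mu> xt yt \<longleftrightarrow>
    xt \<in> hull_box X \<and> yt \<in> hull_box Y \<and> inj (($) xt) \<and> inj (($) yt)
    \<and> zolotarev_max X Y xt yt = \<mu>
    \<and> (\<forall>f g :: real \<Rightarrow> real ^ 'r. \<exists>x\<in>X. \<exists>y\<in>Y. \<mu> \<le> \<bar>1 - (x - y) * (f x \<bullet> g y)\<bar>)
    \<and> (0 < \<mu> \<longrightarrow> (\<forall>(xt' :: real ^ 'r) yt'. xt' \<in> hull_box X \<longrightarrow> yt' \<in> hull_box Y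
        \<longrightarrow> zolotarev_max X Y xt' yt' \<le> \<mu> \<longrightarrow> inj (($) xt') \<and> inj (($) yt')))"

lemma optimal_nodes_degenerate:
  assumes "compact X" and "compact Y" and "X \<noteq> {}" and "Y \<noteq> {}"
    and "Sup X > Inf X" and "Inf X > Sup Y" and "Sup Y > Inf Y"
    and few: "finite X \<and> card X \<le> CARD('r) \<or> finite Y \<and> card Y \<le> CARD('r)"
  shows "\<exists>(xt :: real ^ 'r::finite) yt. optimal_nodes X Y 0 xt yt"
proof -
  have hull: "X \<subseteq> {Inf X..Sup X}" "Y \<subseteq> {Inf Y..Sup Y}"
    using compact_hull[OF assms(1)] compact_hull[OF assms(2)] by auto
  have "\<exists>(xt :: real ^ 'r) yt :: real ^ 'r. xt \<in> hull_box X \<and> yt \<in> hull_box Y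
      \<and> inj (($) xt) \<and> inj (($) yt) \<and> (X \<subseteq> range (($) xt) \<or> Y \<subseteq> range (($) yt))"
  proof -
    have nodes: "\<exists>xt :: real ^ 'r. xt \<in> hull_box Z \<and> inj (($) xt) \<and> S \<subseteq> range (($) xt)"
      if "Inf Z < Sup Z" "finite S \<and> card S \<le> CARD('r)" "S \<subseteq> {Inf Z..Sup Z}" for S Z
      using distinct_nodes_covering[of "Inf Z" "Sup Z" S, where 'r = 'r] that
      unfolding hull_box_def mem_Collect_eq by blast
    obtain xt0 yt0 :: "real ^ 'r" where "xt0 \<in> hull_box X" "inj (($) xt0)" "yt0 \<in> hull_box Y" "inj (($) yt0)"
      using nodes[of X "{}"] nodes[of Y "{}"] assms by auto
    then show ?thesis using few nodes[OF assms(5) _ hull(1)] nodes[OF assms(7) _ hull(2)] by blast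
  qed
  then obtain xt yt :: "real ^ 'r" where xt: "xt \<in> hull_box X" "inj (($) xt)"
    and yt: "yt \<in> hull_box Y" "inj (($) yt)"
    and cover: "X \<subseteq> range (($) xt) \<or> Y \<subseteq> range (($) yt)" by blast
  have "zratio xt yt x y = 0" if "x \<in> X" "y \<in> Y" for x y
    using cover that unfolding zratio_def by fastforce
  then have "zolotarev_max X Y xt yt = 0"
    using zolotarev_max_attained(1)[OF assms(1-4,6) xt(1) yt(1)] by auto
  then have "optimal_nodes X Y 0 xt yt"
    using xt yt assms(3,4) unfolding optimal_nodes_def by fastforce
  then show ?thesis by blast
qed

text \<open>In the nondegenerate case the statements on equioscillations are carried over from the sets \<open>X\<close> and
\<open>uminus ` Y\<close> with nodes numbered by \<open>{..<r}\<close>.\<close>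

lemma optimal_nodes_exist:
  assumes "compact X" and "compact Y" and "X \<noteq> {}" and "Y \<noteq> {}"
    and "Sup X > Inf X" and "Inf X > Sup Y" and "Sup Y > Inf Y"
  shows "\<exists>\<mu> (xt :: real ^ 'r::finite) yt. optimal_nodes X Y \<mu> xt yt"
proof (cases "finite X \<and> card X \<le> CARD('r) \<or> finite Y \<and> card Y \<le> CARD('r)")
  case True
  then show ?thesis using optimal_nodes_degenerate[OF assms True] by blast
next
  case False
  let ?n = "CARD('r)" and ?Y = "uminus ` Y"
  have "card ?Y = card Y" "infinite ?Y \<longleftrightarrow> infinite Y"
    by (auto simp: card_image finite_image_iff)
  with False obtain x0 y0 where x0: "decreasing_to ?n x0" "\<And>i. i \<le> ?n \<Longrightarrow> x0 i \<in> X"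
    and y0: "decreasing_to ?n y0" "\<And>i. i \<le> ?n \<Longrightarrow> y0 i \<in> ?Y"
    using decreasing_points_exist[of X ?n] decreasing_points_exist[of ?Y ?n] by (metis not_le)
  have sep: "0 < x + y" if "x \<in> X" "y \<in> ?Y" for x y
    using compact_hull[OF assms(1)] compact_hull[OF assms(2)] assms(6) that by force
  have "compact ?Y" using assms(2) by (simp add: compact_negations)
  then have "\<exists>x a y b \<mu>. equioscillation ?n x a y b \<mu>
    \<and> (\<forall>i\<le>?n. x i \<in> X) \<and> (\<forall>i\<le>?n. y i \<in> ?Y)
    \<and> (\<forall>x\<in>X. \<forall>y\<in>?Y. \<bar>zprod ?n a b x y\<bar> \<le> \<mu>)"
    by (intro equioscillation_exists[OF assms(1) _ _ x0(1) _ y0(1)]) (use sep x0(2) y0(2) in blast)+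
  then obtain x a y b \<mu> where equi: "equioscillation ?n x a y b \<mu>"
    and x: "\<forall>i\<le>?n. x i \<in> X" and y: "\<forall>i\<le>?n. y i \<in> ?Y"
    and le: "\<forall>x\<in>X. \<forall>y\<in>?Y. \<bar>zprod ?n a b x y\<bar> \<le> \<mu>"
    by (elim exE conjE) (rule that)
  note xa = equioscillationD(1)[OF equi] and yb = equioscillationD(2)[OF equi]
  have x: "x i \<in> X" if "i \<le> ?n" for i using x that by blast
  have y_mem: "- y j \<in> Y" if "j \<le> ?n" for j using y that by auto
  obtain h where h: "bij_betw h {..<?n} (UNIV :: 'r set)"
    using finite_same_card_bij[of "{..<?n}" "UNIV :: 'r set"] by auto
  define h' where "h' = the_inv_into {..<?n} h"
  have h': "bij_betw h' UNIV {..<?n}" unfolding h'_def by (rule bij_betw_the_inv_into[OF h])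
  have h'h: "h' (h k) = k" if "k < ?n" for k
    unfolding h'_def using h that by (intro the_inv_into_f_f) (auto simp: bij_betw_def)
  have h'_less: "h' i < ?n" for i using h' by (auto simp: bij_betw_def)
  define xt where "xt = (\<chi> i. a (h' i))"
  define yt where "yt = (\<chi> i. - b (h' i))"
  have ratio: "zratio xt yt u v = zprod ?n a b u (- v)" for u v
    unfolding zratio_eq_zprod[OF h] zprod_def by (simp add: xt_def yt_def h'h)
  have xt: "xt \<in> hull_box X"
  proof -
    have "Inf X \<le> a k \<and> a k \<le> Sup X" if "k < ?n" for k
      using xa that compact_hull[OF assms(1) x[of k]] compact_hull[OF assms(1) x[of "Suc k"]]
      by (force simp: strictly_interlaced_def)
    then show ?thesis using h'_less by (simp add: hull_box_def xt_def)
  qed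
  have yt: "yt \<in> hull_box Y"
  proof -
    have "Inf Y \<le> - b k \<and> - b k \<le> Sup Y" if "k < ?n" for k
      using yb that compact_hull[OF assms(2) y_mem[of k]] compact_hull[OF assms(2) y_mem[of "Suc k"]]
      by (force simp: strictly_interlaced_def)
    then show ?thesis using h'_less by (simp add: hull_box_def yt_def)
  qed
  have inj: "inj (($) xt)" "inj (($) yt)"
  proof -
    have "inj (\<lambda>i. a (h' i))" "inj (\<lambda>i. b (h' i))"
      using comp_inj_on[of h' UNIV a] comp_inj_on[of h' UNIV b] h'
        strictly_interlaced_inj[OF xa] strictly_interlaced_inj[OF yb]
      by (simp_all add: bij_betw_def comp_def)
    then show "inj (($) xt)" "inj (($) yt)" by (auto simp: xt_def yt_def inj_def)
  qed
  note attained = zolotarev_max_attained[OF assms(1-4,6)]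
  have zmax: "zolotarev_max X Y xt yt = \<mu>"
  proof (rule antisym)
    show "zolotarev_max X Y xt yt \<le> \<mu>"
      using attained(1)[OF xt yt] le by (force simp: ratio)
    show "\<mu> \<le> zolotarev_max X Y xt yt"
      using attained(2)[OF xt yt x[of 0] y_mem[of 0]] equioscillationD(5)[OF equi, of 0 0]
      by (simp add: ratio)
  qed
  have lower: "\<exists>u\<in>X. \<exists>v\<in>Y. \<mu> \<le> \<bar>1 - (u - v) * (f u \<bullet> g v)\<bar>" for f g :: "real \<Rightarrow> real ^ 'r"
  proof -
    obtain i j where ij: "i \<le> ?n" "j \<le> ?n" "\<mu> \<le> \<bar>1 - (x i + y j) * (f (x i) \<bullet> g (- y j))\<bar>"
      using equioscillation_lower_bound[OF refl equi,
          of "\<lambda>i. f (x i)" "\<lambda>j. g (- y j)"] by blast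
    show ?thesis
      by (rule bexI[OF _ x[OF ij(1)]], rule bexI[OF _ y_mem[OF ij(2)]]) (use ij(3) in simp)
  qed
  have distinct: "inj (($) xt') \<and> inj (($) yt')"
    if xt': "xt' \<in> hull_box X" and yt': "yt' \<in> hull_box Y" and le': "zolotarev_max X Y xt' yt' \<le> \<mu>"
    for xt' yt' :: "real ^ 'r"
  proof -
    note apart = hull_box_apart[OF assms(1,2,6) xt' yt']
    let ?a = "\<lambda>k. xt' $ h k" and ?b = "\<lambda>k. - yt' $ h k"
    have pos: "0 < x i + ?b k" "0 < y i + ?a k" if "i \<le> ?n" for i k
      using apart(2)[OF x[OF that], of "h k"] apart(3)[OF y_mem[OF that], of "h k"] by auto
    have le_xy: "\<bar>zprod ?n ?a ?b (x i) (y j)\<bar> \<le> \<mu>" if "i \<le> ?n" "j \<le> ?n" for i j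
      using attained(2)[OF xt' yt' x[OF that(1)] y_mem[OF that(2)]] le'
      unfolding zratio_eq_zprod[OF h] by simp
    have "inj_on ?a {..<?n}"
      by (rule equioscillation_forces_distinct_nodes[OF equi pos le_xy])
    moreover have "inj_on ?b {..<?n}"
      by (rule equioscillation_forces_distinct_nodes[OF equioscillation_swap[OF equi] pos(2,1)])
        (use le_xy in \<open>simp_all add: zprod_swap[of _ ?b]\<close>)
    ultimately have "inj_on (($) xt' \<circ> h) {..<?n}" "inj_on (($) yt' \<circ> h) {..<?n}"
      by (auto simp: inj_on_def)
    then have "inj_on (($) xt') (h ` {..<?n})" "inj_on (($) yt') (h ` {..<?n})"
      by (auto intro: inj_on_imageI)
    then show ?thesis using bij_betw_imp_surj_on[OF h] by simp
  qed
  have "optimal_nodes X Y \<mu> xt yt"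
    unfolding optimal_nodes_def using xt yt inj zmax lower distinct by blast
  then show ?thesis by blast
qed

section \<open>Low-rank approximation and the Zolotarev number\<close>

lemma abs_error_le_max_rel_error:
  "x \<in> X \<Longrightarrow> y \<in> Y \<Longrightarrow> ereal \<bar>1 - (x - y) * (f x \<bullet> g y)\<bar> \<le> max_rel_error X Y f g"
  unfolding max_rel_error_def by (intro SUP_upper2[of x] SUP_upper2[of y]) auto

lemma max_rel_error_skeleton:
  fixes xt yt :: "real ^ 'r::finite"
  assumes "compact X" and "compact Y" and "X \<noteq> {}" and "Y \<noteq> {}" and "Inf X > Sup Y"
    and "xt \<in> hull_box X" and "yt \<in> hull_box Y" and "invertible (cauchy_matrix xt yt)"
    and skel: "\<And>x y. x \<in> X \<Longrightarrow> y \<in> Y \<Longrightarrow> f x \<bullet> g y = skeleton xt yt x y"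
  shows "x \<in> X \<Longrightarrow> y \<in> Y \<Longrightarrow> 1 - (x - y) * (f x \<bullet> g y) = zratio xt yt x y"
    and "max_rel_error X Y f g = ereal (zolotarev_max X Y xt yt)"
proof -
  note apart = hull_box_apart[OF assms(1,2,5-7)]
  have error: "1 - (x - y) * (f x \<bullet> g y) = zratio xt yt x y" if "x \<in> X" "y \<in> Y" for x y
    unfolding skel[OF that]
  proof (rule skeleton_error[OF assms(8)])
    show "xt $ i \<noteq> yt $ j" "x \<noteq> yt $ j" "y \<noteq> xt $ i" for i j
      using apart(1)[of j i] apart(2)[OF that(1), of j] apart(3)[OF that(2), of i] by auto
  qed
  then show "x \<in> X \<Longrightarrow> y \<in> Y \<Longrightarrow> 1 - (x - y) * (f x \<bullet> g y) = zratio xt yt x y" .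
  note attained = zolotarev_max_attained[OF assms(1-7)]
  show "max_rel_error X Y f g = ereal (zolotarev_max X Y xt yt)"
  proof (rule antisym)
    show "max_rel_error X Y f g \<le> ereal (zolotarev_max X Y xt yt)"
      unfolding max_rel_error_def using attained(2) by (intro SUP_least) (simp add: error)
    obtain x y where "x \<in> X" "y \<in> Y" "\<bar>zratio xt yt x y\<bar> = zolotarev_max X Y xt yt"
      using attained(1) by blast
    then show "ereal (zolotarev_max X Y xt yt) \<le> max_rel_error X Y f g"
      using abs_error_le_max_rel_error[of x X y Y f g] error[of x y] by simp
  qed
qed

text \<open>Both minimisation problems have the minimum \<open>\<mu>\<close> of the optimal nodes.  For the Zolotarev problem the
lower bound follows from that for low-rank approximations: nodes that do at least as well as \<open>\<mu> > 0\<close>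
are distinct, hence their skeleton is itself a low-rank approximation with the same error.\<close>

theorem theorem1:
  fixes X Y :: "real set"
  assumes "compact X" and "compact Y" and "X \<noteq> {}" and "Y \<noteq> {}"
    and "Sup X > Inf X" and "Inf X > Sup Y" and "Sup Y > Inf Y"
  shows
    "(INF (f :: real \<Rightarrow> real ^ 'r::finite). INF (g :: real \<Rightarrow> real ^ 'r). max_rel_error X Y f g)
        = ereal (zolotarev_number TYPE('r) X Y)
     \<and> (\<exists>(f :: real \<Rightarrow> real ^ 'r) g. low_rank_minimizer X Y f g
          \<and> (\<exists>x\<in>X. \<exists>y\<in>Y. ereal \<bar>1 - (x - y) * (f x \<bullet> g y)\<bar> = max_rel_error X Y f g))
     \<and> (\<exists>(xt :: real ^ 'r) yt. zolotarev_minimizer X Y xt yt \<and> invertible (cauchy_matrix xt yt))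
     \<and> (\<forall>(xt :: real ^ 'r) yt. zolotarev_minimizer X Y xt yt \<and> zolotarev_number TYPE('r) X Y > 0
          \<longrightarrow> invertible (cauchy_matrix xt yt))
     \<and> (\<forall>(xt :: real ^ 'r) yt. zolotarev_minimizer X Y xt yt \<and> invertible (cauchy_matrix xt yt)
          \<longrightarrow> (\<exists>(f :: real \<Rightarrow> real ^ 'r) g. low_rank_minimizer X Y f g
                \<and> (\<forall>x\<in>X. \<forall>y\<in>Y. f x \<bullet> g y = skeleton xt yt x y)))
     \<and> (\<forall>(xt :: real ^ 'r) yt (f :: real \<Rightarrow> real ^ 'r) g.
          xt \<in> hull_box X \<and> yt \<in> hull_box Y \<and> invertible (cauchy_matrix xt yt)
          \<and> (\<forall>x\<in>X. \<forall>y\<in>Y. f x \<bullet> g y = skeleton xt yt x y)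
          \<longrightarrow> (low_rank_minimizer X Y f g \<longleftrightarrow> zolotarev_minimizer X Y xt yt))"
proof -
  let ?box = "\<lambda>(xt :: real ^ 'r) (yt :: real ^ 'r). xt \<in> hull_box X \<and> yt \<in> hull_box Y"
  obtain \<mu> and xt0 yt0 :: "real ^ 'r" where opt: "optimal_nodes X Y \<mu> xt0 yt0"
    using optimal_nodes_exist[OF assms, where 'r = 'r] by blast
  have box0: "xt0 \<in> hull_box X" "yt0 \<in> hull_box Y" and zmax0: "zolotarev_max X Y xt0 yt0 = \<mu>"
    and lower: "\<And>f g :: real \<Rightarrow> real ^ 'r. \<exists>x\<in>X. \<exists>y\<in>Y. \<mu> \<le> \<bar>1 - (x - y) * (f x \<bullet> g y)\<bar>"
    using opt by (simp_all add: optimal_nodes_def)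
  have invertible_iff: "invertible (cauchy_matrix xt yt) \<longleftrightarrow> inj (($) xt) \<and> inj (($) yt)"
    if "?box xt yt" for xt yt
  proof (rule invertible_cauchy_matrix_iff)
    show "xt $ i \<noteq> yt $ j" for i j
      using that hull_box_apart(1)[OF assms(1,2,6), of xt yt j i] by auto
  qed
  have inv0: "invertible (cauchy_matrix xt0 yt0)"
    using opt invertible_iff by (simp add: optimal_nodes_def)
  have distinct: "invertible (cauchy_matrix xt yt)"
    if "?box xt yt" "zolotarev_max X Y xt yt \<le> \<mu>" "0 < \<mu>" for xt yt
    using opt that unfolding invertible_iff[OF that(1)] optimal_nodes_def by blast
  note skeleton_max = max_rel_error_skeleton[OF assms(1-4,6)]
  have error_ge: "ereal \<mu> \<le> max_rel_error X Y f g" for f g :: "real \<Rightarrow> real ^ 'r"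
  proof -
    obtain x y where "x \<in> X" "y \<in> Y" "\<mu> \<le> \<bar>1 - (x - y) * (f x \<bullet> g y)\<bar>" using lower by blast
    then show ?thesis
      using abs_error_le_max_rel_error[of x X y Y f g] by (meson ereal_less_eq(3) order_trans)
  qed
  have zmax_ge: "\<mu> \<le> zolotarev_max X Y xt yt" if "?box xt yt" for xt yt
  proof (cases "0 < \<mu> \<and> zolotarev_max X Y xt yt \<le> \<mu>")
    case True
    then have "max_rel_error X Y (skeleton_left xt yt) (skeleton_right xt)
        = ereal (zolotarev_max X Y xt yt)"
      using that distinct by (intro skeleton_max(2)) (auto simp: skeleton_eq_inner)
    then show ?thesis using error_ge by (metis ereal_less_eq(3))
  next
    case False
    obtain x y where "x \<in> X" "y \<in> Y" using assms(3,4) by blast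
    then have "0 \<le> zolotarev_max X Y xt yt"
      using zolotarev_max_attained(2)[OF assms(1-4,6), of xt yt x y] that by auto
    then show ?thesis using False by auto
  qed
  have number: "zolotarev_number TYPE('r) X Y = \<mu>"
  proof -
    let ?F = "\<lambda>(xt, yt). zolotarev_max X Y xt yt"
      and ?B = "(hull_box X :: (real ^ 'r) set) \<times> (hull_box Y :: (real ^ 'r) set)"
    have "Inf (?F ` ?B) = \<mu>"
      using zmax_ge box0 zmax0
      by (intro cInf_eq_minimum) (auto intro!: image_eqI[of _ _ "(xt0, yt0)"])
    then show ?thesis by (simp add: zolotarev_number_def)
  qed
  have zmin_iff: "zolotarev_minimizer X Y xt yt \<longleftrightarrow> ?box xt yt \<and> zolotarev_max X Y xt yt = \<mu>" for xt yt
  proof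
    assume min: "zolotarev_minimizer X Y xt yt"
    then have box: "?box xt yt" by (simp add: zolotarev_minimizer_def is_arg_min_def)
    have "\<not> zolotarev_max X Y xt0 yt0 < zolotarev_max X Y xt yt"
      using min box0 by (auto simp: zolotarev_minimizer_def is_arg_min_def)
    then show "?box xt yt \<and> zolotarev_max X Y xt yt = \<mu>"
      using box zmax_ge[OF box] zmax0 by simp
  next
    assume "?box xt yt \<and> zolotarev_max X Y xt yt = \<mu>"
    then show "zolotarev_minimizer X Y xt yt"
      using zmax_ge by (auto simp: zolotarev_minimizer_def is_arg_min_def not_less)
  qed
  define f0 where "f0 = skeleton_left xt0 yt0"
  define g0 where "g0 = skeleton_right xt0"
  have skel0: "f0 x \<bullet> g0 y = skeleton xt0 yt0 x y" for x y
    by (simp add: f0_def g0_def skeleton_eq_inner)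
  have max0: "max_rel_error X Y f0 g0 = ereal \<mu>"
    using skeleton_max(2)[OF box0 inv0, of f0 g0] skel0 zmax0 by simp
  have lmin_iff: "low_rank_minimizer X Y f g \<longleftrightarrow> max_rel_error X Y f g = ereal \<mu>"
    for f g :: "real \<Rightarrow> real ^ 'r"
  proof
    assume "low_rank_minimizer X Y f g"
    then have "\<not> max_rel_error X Y f0 g0 < max_rel_error X Y f g"
      unfolding low_rank_minimizer_def is_arg_min_def by auto
    then show "max_rel_error X Y f g = ereal \<mu>" using max0 error_ge by (simp add: antisym)
  next
    assume "max_rel_error X Y f g = ereal \<mu>"
    then show "low_rank_minimizer X Y f g"
      using error_ge unfolding low_rank_minimizer_def is_arg_min_def by (auto simp: not_less)
  qed
  have "(INF (f :: real \<Rightarrow> real ^ 'r). INF (g :: real \<Rightarrow> real ^ 'r). max_rel_error X Y f g) = ereal \<mu>"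
  proof (rule antisym)
    show "(INF (f :: real \<Rightarrow> real ^ 'r). INF (g :: real \<Rightarrow> real ^ 'r). max_rel_error X Y f g) \<le> ereal \<mu>"
      using max0 by (intro INF_lower2[of f0] INF_lower2[of g0]) auto
  qed (intro INF_greatest error_ge)
  moreover have "\<exists>x\<in>X. \<exists>y\<in>Y. ereal \<bar>1 - (x - y) * (f0 x \<bullet> g0 y)\<bar> = max_rel_error X Y f0 g0"
  proof -
    obtain x y where xy: "x \<in> X" "y \<in> Y" "\<bar>zratio xt0 yt0 x y\<bar> = \<mu>"
      using zolotarev_max_attained(1)[OF assms(1-4,6) box0] zmax0 by auto
    then have "1 - (x - y) * (f0 x \<bullet> g0 y) = zratio xt0 yt0 x y"
      using skeleton_max(1)[OF box0 inv0 skel0] by blast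
    then have "ereal \<bar>1 - (x - y) * (f0 x \<bullet> g0 y)\<bar> = max_rel_error X Y f0 g0"
      using xy(3) max0 by simp
    with xy(1,2) show ?thesis by blast
  qed
  moreover have "\<exists>(f :: real \<Rightarrow> real ^ 'r) g. low_rank_minimizer X Y f g
      \<and> (\<forall>x\<in>X. \<forall>y\<in>Y. f x \<bullet> g y = skeleton xt yt x y)"
    if "zolotarev_minimizer X Y xt yt" "invertible (cauchy_matrix xt yt)" for xt yt :: "real ^ 'r"
  proof -
    have skel: "skeleton_left xt yt x \<bullet> skeleton_right xt y = skeleton xt yt x y" for x y
      by (simp add: skeleton_eq_inner)
    have "low_rank_minimizer X Y (skeleton_left xt yt) (skeleton_right xt)"
      using that skeleton_max(2)[of xt yt, OF _ _ that(2) skel] by (simp add: lmin_iff zmin_iff)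
    with skel show ?thesis by blast
  qed
  moreover have "low_rank_minimizer X Y f g \<longleftrightarrow> zolotarev_minimizer X Y xt yt"
    if "?box xt yt" "invertible (cauchy_matrix xt yt)"
      "\<forall>x\<in>X. \<forall>y\<in>Y. f x \<bullet> g y = skeleton xt yt x y"
    for xt yt and f g :: "real \<Rightarrow> real ^ 'r"
    using that skeleton_max(2)[of xt yt f g] by (simp add: lmin_iff zmin_iff)
  moreover have "low_rank_minimizer X Y f0 g0" using max0 by (simp add: lmin_iff)
  moreover have "zolotarev_minimizer X Y xt0 yt0" using box0 zmax0 by (simp add: zmin_iff)
  moreover have "invertible (cauchy_matrix xt yt)"
    if "zolotarev_minimizer X Y xt yt" "0 < \<mu>" for xt yt :: "real ^ 'r"
    using that distinct[of xt yt] by (simp add: zmin_iff)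
  ultimately show ?thesis using inv0 unfolding number by blast
qed

end
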